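(* Consider exact Bayesian network discovery on $V=\{1,\dots,p\}$ with a decomposable score, a search space with in-degree restricted by a constant, and a score for which pairwise edges are score-equivalent. Then there is an exact discovery algorithm (one which, on every input, returns a DAG that is provably of maximal score among all DAGs of the search space, with no a priori restriction to matchings) with the following property: whenever an optimal DAG is a matching, the algorithm finds it and proves its optimality among all DAGs in time polynomial in $p$; and, once the score tables have been computed, in time $O(p^2)$.
   Context: For $i\in V$ and a parent set $\mathrm{Pa}\subseteq V\setminus\{i\}$ there is a real local score $\sigma(i,\mathrm{Pa}\mid D)$, depending on the fixed data $D$. The score of a DAG $\mathcal G$ on $V$ is $\sigma(\mathcal G)=\sum_{i=1}^p\sigma(i,\mathrm{Pa}_i\mid D)$, where $\mathrm{Pa}_i$ is the set of parents of $i$ in $\mathcal G$. Exact discovery means finding a DAG of maximal score (an optimal DAG). Restricted in-degree: only parent sets of size at most a fixed constant are allowed. Each local score can be evaluated in polynomial time. For $U\subseteq V\setminus\{i\}$, $s(i\mid U)=\max_{\mathrm{Pa}\subseteq U}\sigma(i,\mathrm{Pa}\mid D)$ (maximum over allowed parent sets). Pairwise score-equivalence: $\sigma(i,\{j\}\mid D)+\sigma(j,\emptyset\mid D)=\sigma(j,\{i\}\mid D)+\sigma(i,\emptyset\mid D)$ for all $i\ne j$. "Score tables" are tables giving the values $s(i\mid U)$ for $U\in\{\emptyset,\{j\},V\setminus\{i\},V\setminus\{i,j\}\}$ for all $i\neq j$, with $O(1)$ lookup; equivalently, the matrices $F_{ij}=s(i\mid\{j\})-s(i\mid\emptyset)$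 and $G_{ij}=\max\{s(i\mid V\setminus\{i\})+s(j\mid V\setminus\{i,j\}),\, s(j\mid V\setminus\{j\})+s(i\mid V\setminus\{i,j\})\}-s(i\mid V\setminus\{i\})-s(j\mid V\setminus\{j\})$ together with the values $s(i\mid\emptyset)$ and $s(i\mid V\setminus\{i\})$. Running time counts arithmetic operations and comparisons on scores. A matching is a DAG in which every node has at most one neighbour (is an endpoint of at most one edge). *)

theory Defs
  imports Complex_Main "HOL-Library.Landau_Symbols"
begin

section \<open>Bayesian network discovery with a decomposable score\<close>

abbreviation nodes :: "nat \<Rightarrow> nat set" where
  "nodes p \<equiv> {1..p}"

text \<open>A directed graph is its set of edges; \<open>(j, i) \<in> E\<close> is the edge from \<open>j\<close> to \<open>i\<close>.\<close>

definition dag :: "nat \<Rightarrow> (nat \<times> nat) set \<Rightarrow> bool" where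
  "dag p E \<longleftrightarrow> E \<subseteq> nodes p \<times> nodes p \<and> acyclic E"

definition parents :: "(nat \<times> nat) set \<Rightarrow> nat \<Rightarrow> nat set" where
  "parents E i = {j. (j, i) \<in> E}"

definition search_space :: "nat \<Rightarrow> nat \<Rightarrow> (nat \<times> nat) set set" where
  "search_space k p = {E. dag p E \<and> (\<forall>i\<in>nodes p. card (parents E i) \<le> k)}"

text \<open>The local score \<open>\<sigma> i Pa\<close> is relevant only for \<open>i \<in> nodes p\<close> and
  \<open>Pa \<subseteq> nodes p - {i}\<close>; the data are fixed and hence part of \<open>\<sigma>\<close>.\<close>

type_synonym local_score = "nat \<Rightarrow> nat set \<Rightarrow> real"

definition graph_score :: "nat \<Rightarrow> local_score \<Rightarrow> (nat \<times> nat) set \<Rightarrow> real" where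
  "graph_score p \<sigma> E = (\<Sum>i\<in>nodes p. \<sigma> i (parents E i))"

definition optimal_dag :: "nat \<Rightarrow> nat \<Rightarrow> local_score \<Rightarrow> (nat \<times> nat) set \<Rightarrow> bool" where
  "optimal_dag k p \<sigma> E \<longleftrightarrow>
     E \<in> search_space k p \<and> (\<forall>E'\<in>search_space k p. graph_score p \<sigma> E' \<le> graph_score p \<sigma> E)"

definition matching_dag :: "nat \<Rightarrow> (nat \<times> nat) set \<Rightarrow> bool" where
  "matching_dag p E \<longleftrightarrow>
     dag p E \<and> (\<forall>i\<in>nodes p. card {j. (i, j) \<in> E \<or> (j, i) \<in> E} \<le> 1)"

definition pairwise_score_equivalent :: "nat \<Rightarrow> local_score \<Rightarrow> bool" where
  "pairwise_score_equivalent p \<sigma> \<longleftrightarrow>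
     (\<forall>i\<in>nodes p. \<forall>j\<in>nodes p. i \<noteq> j \<longrightarrow> \<sigma> i {j} + \<sigma> j {} = \<sigma> j {i} + \<sigma> i {})"

definition best_score :: "nat \<Rightarrow> local_score \<Rightarrow> nat \<Rightarrow> nat set \<Rightarrow> real" where
  "best_score k \<sigma> i U = Max {\<sigma> i Pa | Pa. Pa \<subseteq> U \<and> card Pa \<le> k}"


section \<open>Model of computation\<close>

text \<open>
  A random access machine, programmed in a while language. There are two kinds of memory cells,
  one for natural numbers (node indices, counters, flags) and one for scores. A cell is addressed
  by an array name and a list of indices, whose length is fixed in the program text; a scalar
  variable has the empty list of indices. Scores can be added, subtracted and compared, and
  they influence the natural numbers only through comparisons. Natural numbers can be added,
  subtracted and compared but not multiplied, so that unit cost is a realistic measure. Every operation counts,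
  not only the arithmetic operations and comparisons on scores.
\<close>

record state =
  ints :: "string \<Rightarrow> nat list \<Rightarrow> nat"
  scores :: "string \<Rightarrow> nat list \<Rightarrow> real"

datatype iexp =
    INum nat
  | ICell string "iexp list"
  | IAdd iexp iexp
  | ISub iexp iexp

datatype sexp =
    SZero
  | SCell string "iexp list"
  | SAdd sexp sexp
  | SSub sexp sexp

datatype bexp =
    ILess iexp iexp
  | SLess sexp sexp
  | BNot bexp
  | BAnd bexp bexp

text \<open>\<open>Query x xs i a as\<close> stores in the score cell \<open>x[xs]\<close> the local score of node \<open>i\<close> for
  the parent set whose characteristic function is the row \<open>a[as, _]\<close>.\<close>

datatype com =
    Skip
  | AssignI string "iexp list" iexp
  | AssignS string "iexp list" sexp
  | Query string "iexp list" iexp string "iexp list"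
  | Seq com com  (infixr ";;" 60)
  | Cond bexp com com
  | While bexp com

fun ival :: "state \<Rightarrow> iexp \<Rightarrow> nat" where
  "ival s (INum n) = n"
| "ival s (ICell x es) = ints s x (map (ival s) es)"
| "ival s (IAdd a b) = ival s a + ival s b"
| "ival s (ISub a b) = ival s a - ival s b"

fun sval :: "state \<Rightarrow> sexp \<Rightarrow> real" where
  "sval s SZero = 0"
| "sval s (SCell x es) = scores s x (map (ival s) es)"
| "sval s (SAdd a b) = sval s a + sval s b"
| "sval s (SSub a b) = sval s a - sval s b"

fun bval :: "state \<Rightarrow> bexp \<Rightarrow> bool" where
  "bval s (ILess a b) \<longleftrightarrow> ival s a < ival s b"
| "bval s (SLess a b) \<longleftrightarrow> sval s a < sval s b"
| "bval s (BNot b) \<longleftrightarrow> \<not> bval s b"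
| "bval s (BAnd b c) \<longleftrightarrow> bval s b \<and> bval s c"

fun icost :: "iexp \<Rightarrow> nat" where
  "icost (INum n) = 1"
| "icost (ICell x es) = 1 + sum_list (map icost es)"
| "icost (IAdd a b) = 1 + icost a + icost b"
| "icost (ISub a b) = 1 + icost a + icost b"

abbreviation icosts :: "iexp list \<Rightarrow> nat" where
  "icosts es \<equiv> sum_list (map icost es)"

fun scost :: "sexp \<Rightarrow> nat" where
  "scost SZero = 1"
| "scost (SCell x es) = 1 + icosts es"
| "scost (SAdd a b) = 1 + scost a + scost b"
| "scost (SSub a b) = 1 + scost a + scost b"

fun bcost :: "bexp \<Rightarrow> nat" where
  "bcost (ILess a b) = 1 + icost a + icost b"
| "bcost (SLess a b) = 1 + scost a + scost b"
| "bcost (BNot b) = 1 + bcost b"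
| "bcost (BAnd b c) = 1 + bcost b + bcost c"

definition set_int :: "string \<Rightarrow> nat list \<Rightarrow> nat \<Rightarrow> state \<Rightarrow> state" where
  "set_int x is n s = s\<lparr>ints := (ints s)(x := (ints s x)(is := n))\<rparr>"

definition set_score :: "string \<Rightarrow> nat list \<Rightarrow> real \<Rightarrow> state \<Rightarrow> state" where
  "set_score x is r s = s\<lparr>scores := (scores s)(x := (scores s x)(is := r))\<rparr>"

definition row_set :: "nat \<Rightarrow> state \<Rightarrow> string \<Rightarrow> nat list \<Rightarrow> nat set" where
  "row_set p s a is = {j \<in> nodes p. ints s a (is @ [j]) \<noteq> 0}"

text \<open>\<open>exec p \<sigma> \<tau> c s t s'\<close>: on the input with \<open>p\<close> nodes and local score \<open>\<sigma>\<close>, the program \<open>c\<close>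
  started in state \<open>s\<close> halts in state \<open>s'\<close> after \<open>t\<close> steps, where \<open>\<tau> i Pa\<close> is the time
  taken by the evaluation of \<open>\<sigma> i Pa\<close>.\<close>

inductive exec ::
  "nat \<Rightarrow> local_score \<Rightarrow> (nat \<Rightarrow> nat set \<Rightarrow> nat) \<Rightarrow> com \<Rightarrow> state \<Rightarrow> nat \<Rightarrow> state \<Rightarrow> bool"
  for p :: nat and \<sigma> :: local_score and \<tau> :: "nat \<Rightarrow> nat set \<Rightarrow> nat" where
  Skip: "exec p \<sigma> \<tau> Skip s 1 s"
| AssignI: "exec p \<sigma> \<tau> (AssignI x xs e) s (1 + icosts xs + icost e)
     (set_int x (map (ival s) xs) (ival s e) s)"
| AssignS: "exec p \<sigma> \<tau> (AssignS x xs e) s (1 + icosts xs + scost e)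
     (set_score x (map (ival s) xs) (sval s e) s)"
| Query: "i = ival s e \<Longrightarrow> Pa = row_set p s a (map (ival s) as) \<Longrightarrow>
     exec p \<sigma> \<tau> (Query x xs e a as) s (1 + icosts xs + icost e + icosts as + \<tau> i Pa)
     (set_score x (map (ival s) xs) (\<sigma> i Pa) s)"
| Seq: "exec p \<sigma> \<tau> c1 s1 t1 s2 \<Longrightarrow> exec p \<sigma> \<tau> c2 s2 t2 s3 \<Longrightarrow>
     exec p \<sigma> \<tau> (c1 ;; c2) s1 (t1 + t2) s3"
| IfTrue: "bval s b \<Longrightarrow> exec p \<sigma> \<tau> c1 s t s' \<Longrightarrow> exec p \<sigma> \<tau> (Cond b c1 c2) s (1 + bcost b + t) s'"
| IfFalse: "\<not> bval s b \<Longrightarrow> exec p \<sigma> \<tau> c2 s t s' \<Longrightarrow> exec p \<sigma> \<tau> (Cond b c1 c2) s (1 + bcost b + t) s'"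
| WhileFalse: "\<not> bval s b \<Longrightarrow> exec p \<sigma> \<tau> (While b c) s (1 + bcost b) s"
| WhileTrue: "bval s1 b \<Longrightarrow> exec p \<sigma> \<tau> c s1 t1 s2 \<Longrightarrow> exec p \<sigma> \<tau> (While b c) s2 t2 s3 \<Longrightarrow>
     exec p \<sigma> \<tau> (While b c) s1 (1 + bcost b + t1 + t2) s3"

inductive_cases exec_elims:
  "exec p \<sigma> \<tau> Skip s t s'"
  "exec p \<sigma> \<tau> (AssignI x xs e) s t s'"
  "exec p \<sigma> \<tau> (AssignS x xs se) s t s'"
  "exec p \<sigma> \<tau> (Query x xs e a as) s t s'"
  "exec p \<sigma> \<tau> (c1 ;; c2) s t s'"
  "exec p \<sigma> \<tau> (Cond b c1 c2) s t s'"
  "exec p \<sigma> \<tau> (While b c) s t s'"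

lemma exec_deterministic:
  "exec p \<sigma> \<tau> c s t s' \<Longrightarrow> exec p \<sigma> \<tau> c s u s'' \<Longrightarrow> t = u \<and> s' = s''"
proof (induction arbitrary: u s'' rule: exec.induct)
  case (Seq c1 s1 t1 s2 c2 t2 s3)
  show ?case
    by (rule exec_elims(5)[OF Seq.prems]) (auto dest: Seq.IH)
next
  case (IfTrue s b c1 t s' c2)
  show ?case
    by (rule exec_elims(6)[OF IfTrue.prems]) (auto simp: IfTrue.hyps dest: IfTrue.IH)
next
  case (IfFalse s b c2 t s' c1)
  show ?case
    by (rule exec_elims(6)[OF IfFalse.prems]) (auto simp: IfFalse.hyps dest: IfFalse.IH)
next
  case (WhileFalse s b c)
  show ?case
    by (rule exec_elims(7)[OF WhileFalse.prems]) (auto simp: WhileFalse.hyps)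
next
  case (WhileTrue s1 b c t1 s2 t2 s3)
  show ?case
    by (rule exec_elims(7)[OF WhileTrue.prems]) (auto simp: WhileTrue.hyps dest: WhileTrue.IH)
next
  case (Skip s)
  show ?case by (rule exec_elims(1)[OF Skip.prems]) simp
next
  case (AssignI x xs e s)
  show ?case by (rule exec_elims(2)[OF AssignI.prems]) simp
next
  case (AssignS x xs e s)
  show ?case by (rule exec_elims(3)[OF AssignS.prems]) simp
next
  case (Query i s e Pa a as x xs)
  show ?case by (rule exec_elims(4)[OF Query.prems]) (simp add: Query.hyps)
qed

text \<open>The input: the number of nodes is in the integer cell \<open>p\<close>, all other cells are zero, and
  the local score is accessible through \<open>Query\<close>.\<close>

definition init_state :: "nat \<Rightarrow> state" where
  "init_state p =
     \<lparr>ints = (\<lambda>x is. if x = ''p'' \<and> is = [] then p else 0), scores = (\<lambda>x is. 0)\<rparr>"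

text \<open>The score tables are stored in arrays; the other cells are arbitrary.\<close>

definition holds_score_tables :: "nat \<Rightarrow> nat \<Rightarrow> local_score \<Rightarrow> state \<Rightarrow> bool" where
  "holds_score_tables k p \<sigma> s \<longleftrightarrow>
     ints s ''p'' [] = p \<and>
     (\<forall>i\<in>nodes p.
        scores s ''empty'' [i] = best_score k \<sigma> i {} \<and>
        scores s ''others'' [i] = best_score k \<sigma> i (nodes p - {i}) \<and>
        (\<forall>j\<in>nodes p. j \<noteq> i \<longrightarrow>
           scores s ''single'' [i, j] = best_score k \<sigma> i {j} \<and>
           scores s ''without'' [i, j] = best_score k \<sigma> i (nodes p - {i, j})))"

text \<open>The output is the adjacency matrix in the integer array \<open>edge\<close>.\<close>

definition output_graph :: "nat \<Rightarrow> state \<Rightarrow> (nat \<times> nat) set" where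
  "output_graph p s = {(j, i) \<in> nodes p \<times> nodes p. ints s ''edge'' [j, i] \<noteq> 0}"

definition returns :: "nat \<Rightarrow> local_score \<Rightarrow> (nat \<Rightarrow> nat set \<Rightarrow> nat) \<Rightarrow>
    com \<Rightarrow> state \<Rightarrow> nat \<Rightarrow> (nat \<times> nat) set \<Rightarrow> bool" where
  "returns p \<sigma> \<tau> c s t E \<longleftrightarrow> (\<exists>s'. exec p \<sigma> \<tau> c s t s' \<and> E = output_graph p s')"

text \<open>Correctness on every input, with no assumption on the optimal graphs: the fact that the
  program has halted proves that its output is optimal among all graphs of the search space.\<close>

definition exact_discovery :: "nat \<Rightarrow> (nat \<Rightarrow> local_score \<Rightarrow> state \<Rightarrow> bool) \<Rightarrow> com \<Rightarrow> bool" where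
  "exact_discovery k start c \<longleftrightarrow>
     (\<forall>p \<sigma> \<tau> s. pairwise_score_equivalent p \<sigma> \<longrightarrow> start p \<sigma> s \<longrightarrow>
        (\<exists>t E. returns p \<sigma> \<tau> c s t E \<and> optimal_dag k p \<sigma> E))"

definition eval_time_within :: "nat \<Rightarrow> nat \<Rightarrow> real \<Rightarrow> (nat \<Rightarrow> nat set \<Rightarrow> nat) \<Rightarrow> bool" where
  "eval_time_within k p b \<tau> \<longleftrightarrow>
     (\<forall>i\<in>nodes p. \<forall>Pa. Pa \<subseteq> nodes p - {i} \<longrightarrow> card Pa \<le> k \<longrightarrow> real (\<tau> i Pa) \<le> b)"

definition polynomially_bounded :: "(nat \<Rightarrow> real) \<Rightarrow> bool" where
  "polynomially_bounded f \<longleftrightarrow> (\<exists>d::nat. f \<in> O(\<lambda>p. real p ^ d))"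

end

theory Submission
  imports Defs
begin

text \<open>
  The gain \<open>s(i | {j}) - s(i | {})\<close> of an edge does not depend on its orientation, by score
  equivalence. If an optimal graph is a matching, then moving a node of the matching to the end of
  a topological order and giving it its best parents cannot increase the score; neither can moving
  both endpoints of an edge to the end. Since every edge of the matching can be reversed, this
  shows that an edge \<open>ij\<close> with positive gain satisfies \<open>s(i | V - {i}) = s(i | {j})\<close> and
  \<open>s(i | V - {i, j}) = s(i | {})\<close>, and that a node \<open>i\<close> without such an edge satisfies
  \<open>s(i | V - {i}) = s(i | {})\<close>. Conversely, these equations between table entries force the
  edges of positive gain to form a matching, and they bound the joint contribution of each pair
  \<open>ij\<close> in an arbitrary acyclic graph (where \<open>ij\<close> and \<open>ji\<close> are not both edges) by its
  contribution in this matching, which is therefore optimal. If the test fails, the program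
  searches all rankings of the nodes.
\<close>

section \<open>Weakest preconditions with time\<close>

text \<open>The equations tested are both necessary and sufficient for some optimal graph to be a
  matching. Hence the exhaustive search is entered only on inputs where no fast answer is promised,
  and its time need not be bounded. When the test succeeds, the edges of positive gain already form
  a matching, so no maximum-weight matching has to be computed: a constant number of comparisons per
  ordered pair gives O(p^2).

  The machine shapes the rest. It has no multiplication or division, and the evaluation of a local
  score reads the parent set from an array row. Parent sets and rankings are therefore enumerated by
  a counter whose digits in base p+1 are extracted by repeated subtraction: about (p+1)^k codes for
  parent sets, polynomial because k is fixed in the program text, and about (p+1)^p codes for
  rankings. The rules below give total correctness, with postconditions that see the exact number of
  steps; as execution is deterministic, one halting run determines time and output.\<close>

definition wp :: "nat \<Rightarrow> local_score \<Rightarrow> (nat \<Rightarrow> nat set \<Rightarrow> nat) \<Rightarrow> com \<Rightarrow> state \<Rightarrow>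
    (nat \<Rightarrow> state \<Rightarrow> bool) \<Rightarrow> bool" where
  "wp p \<sigma> \<tau> c s Q \<longleftrightarrow> (\<exists>t s'. exec p \<sigma> \<tau> c s t s' \<and> Q t s')"

lemma wp_mono:
  assumes "wp p \<sigma> \<tau> c s Q" "\<And>t s'. Q t s' \<Longrightarrow> R t s'"
  shows "wp p \<sigma> \<tau> c s R"
  using assms unfolding wp_def by blast

lemma wp_Skip [simp]: "wp p \<sigma> \<tau> Skip s Q \<longleftrightarrow> Q 1 s"
  unfolding wp_def by (rule iffI, elim exE conjE, erule exec_elims(1), simp, intro exI conjI, rule exec.Skip)

lemma wp_AssignI [simp]:
  "wp p \<sigma> \<tau> (AssignI x xs e) s Q \<longleftrightarrow>
     Q (1 + icosts xs + icost e) (set_int x (map (ival s) xs) (ival s e) s)"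
  unfolding wp_def by (rule iffI, elim exE conjE, erule exec_elims(2), simp, intro exI conjI, rule exec.AssignI)

lemma wp_AssignS [simp]:
  "wp p \<sigma> \<tau> (AssignS x xs e) s Q \<longleftrightarrow>
     Q (1 + icosts xs + scost e) (set_score x (map (ival s) xs) (sval s e) s)"
  unfolding wp_def by (rule iffI, elim exE conjE, erule exec_elims(3), simp, intro exI conjI, rule exec.AssignS)

lemma wp_Query [simp]:
  "wp p \<sigma> \<tau> (Query x xs e a as) s Q \<longleftrightarrow>
     (let i = ival s e; Pa = row_set p s a (map (ival s) as)
      in Q (1 + icosts xs + icost e + icosts as + \<tau> i Pa)
           (set_score x (map (ival s) xs) (\<sigma> i Pa) s))"
  unfolding wp_def Let_def
  by (rule iffI, elim exE conjE, erule exec_elims(4), simp, intro exI conjI, rule exec.Query[OF refl refl])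

lemma wp_Seq [simp]:
  "wp p \<sigma> \<tau> (c1 ;; c2) s Q \<longleftrightarrow> wp p \<sigma> \<tau> c1 s (\<lambda>t s'. wp p \<sigma> \<tau> c2 s' (\<lambda>t' s''. Q (t + t') s''))"
  unfolding wp_def by (blast elim: exec_elims intro: exec.intros)

lemma wp_Cond [simp]:
  "wp p \<sigma> \<tau> (Cond b c1 c2) s Q \<longleftrightarrow>
     wp p \<sigma> \<tau> (if bval s b then c1 else c2) s (\<lambda>t s'. Q (1 + bcost b + t) s')"
  unfolding wp_def by (cases "bval s b") (fastforce elim!: exec_elims(6) intro: exec.IfTrue exec.IfFalse)+

text \<open>The variant \<open>f\<close> strictly decreases, so its bound \<open>n\<close> limits
  the number of rounds; each round costs a test and at most \<open>T\<close>, and one failing test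
  comes at the end. Termination is part of the conclusion.\<close>

lemma wp_While:
  assumes step: "\<And>s. I s \<Longrightarrow> bval s b \<Longrightarrow> wp p \<sigma> \<tau> c s (\<lambda>t s'. t \<le> T \<and> I s' \<and> f s' < (f s :: nat))"
    and "I s" "f s \<le> n"
  shows "wp p \<sigma> \<tau> (While b c) s
    (\<lambda>t s'. t \<le> 1 + bcost b + n * (1 + bcost b + T) \<and> I s' \<and> \<not> bval s' b)"
  using assms(2,3)
proof (induction n arbitrary: s)
  case 0
  \<comment> \<open>A further round would need a variant below 0.\<close>
  then have "\<not> bval s b"
    using step[of s] by (auto simp: wp_def)
  with 0 show ?case
    unfolding wp_def using exec.WhileFalse[of s b p \<sigma> \<tau> c] by auto
next
  case (Suc n)
  show ?case
  proof (cases "bval s b")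
    case False
    with Suc show ?thesis
      unfolding wp_def using exec.WhileFalse[of s b p \<sigma> \<tau> c] by fastforce
  next
    case True
    then obtain t1 s2 where 1: "exec p \<sigma> \<tau> c s t1 s2" "t1 \<le> T" "I s2" "f s2 < f s"
      using step[OF Suc.prems(1)] unfolding wp_def by blast
    obtain t2 s3 where 2: "exec p \<sigma> \<tau> (While b c) s2 t2 s3"
      "t2 \<le> 1 + bcost b + n * (1 + bcost b + T)" "I s3" "\<not> bval s3 b"
      using Suc.IH[OF 1(3)] 1(4) Suc.prems(2) unfolding wp_def by force
    show ?thesis
      unfolding wp_def using exec.WhileTrue[OF True 1(1) 2(1)] 1(2) 2 by fastforce
  qed
qed

section \<open>Arrays that a program may write, and values that it leaves alone\<close>

fun iarrays :: "com \<Rightarrow> string set" where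
  "iarrays (AssignI x xs e) = {x}"
| "iarrays (c1 ;; c2) = iarrays c1 \<union> iarrays c2"
| "iarrays (Cond b c1 c2) = iarrays c1 \<union> iarrays c2"
| "iarrays (While b c) = iarrays c"
| "iarrays _ = {}"

fun sarrays :: "com \<Rightarrow> string set" where
  "sarrays (AssignS x xs e) = {x}"
| "sarrays (Query x xs e a as) = {x}"
| "sarrays (c1 ;; c2) = sarrays c1 \<union> sarrays c2"
| "sarrays (Cond b c1 c2) = sarrays c1 \<union> sarrays c2"
| "sarrays (While b c) = sarrays c"
| "sarrays _ = {}"

text \<open>The approximation is by whole arrays and is read off the syntax, so that preservation is
  proved once for all programs. Where single cells matter, as in \<open>edge\<close> and in the
  score tables, the specifications say separately which cells survive.\<close>

definition frame :: "com \<Rightarrow> state \<Rightarrow> state \<Rightarrow> bool" where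
  "frame c s s' \<longleftrightarrow>
     (\<forall>x js. x \<notin> iarrays c \<longrightarrow> ints s' x js = ints s x js) \<and>
     (\<forall>x js. x \<notin> sarrays c \<longrightarrow> scores s' x js = scores s x js)"

lemma frame_ints: "frame c s s' \<Longrightarrow> x \<notin> iarrays c \<Longrightarrow> ints s' x js = ints s x js"
  and frame_scores: "frame c s s' \<Longrightarrow> x \<notin> sarrays c \<Longrightarrow> scores s' x js = scores s x js"
  by (auto simp: frame_def)

lemma ints_set_int [simp]:
  "ints (set_int x is n s) y js = (if y = x \<and> js = is then n else ints s y js)"
  by (auto simp: set_int_def)

lemma scores_set_score [simp]:
  "scores (set_score x is r s) y js = (if y = x \<and> js = is then r else scores s y js)"
  by (auto simp: set_score_def)

lemma scores_set_int [simp]: "scores (set_int x is n s) = scores s"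
  by (simp add: set_int_def)

lemma ints_set_score [simp]: "ints (set_score x is r s) = ints s"
  by (simp add: set_score_def)

lemma exec_frame: "exec p \<sigma> \<tau> c s t s' \<Longrightarrow> frame c s s'"
  by (induction rule: exec.induct) (auto simp: frame_def set_int_def set_score_def)

lemma wp_frame: "wp p \<sigma> \<tau> c s Q \<Longrightarrow> wp p \<sigma> \<tau> c s (\<lambda>t s'. Q t s' \<and> frame c s s')"
  unfolding wp_def using exec_frame by blast

fun ivars :: "iexp \<Rightarrow> string set" where
  "ivars (INum n) = {}"
| "ivars (ICell x es) = insert x (\<Union> (ivars ` set es))"
| "ivars (IAdd a b) = ivars a \<union> ivars b"
| "ivars (ISub a b) = ivars a \<union> ivars b"

text \<open>Used for the bound of a counting loop, which is evaluated anew at each test and must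
  keep its value while the body runs.\<close>

lemma ival_cong: "(\<And>x js. x \<in> ivars e \<Longrightarrow> ints s' x js = ints s x js) \<Longrightarrow> ival s' e = ival s e"
proof (induction e)
  case (ICell x es)
  then have "map (ival s') es = map (ival s) es"
    by (intro map_cong refl) auto
  with ICell.prems show ?case
    by (simp del: map_eq_conv)
qed auto

abbreviation var :: "string \<Rightarrow> iexp" where
  "var x \<equiv> ICell x []"

definition For :: "string \<Rightarrow> nat \<Rightarrow> iexp \<Rightarrow> com \<Rightarrow> com" where
  "For v lo e c = AssignI v [] (INum lo) ;;
     While (BNot (ILess e (var v))) (c ;; AssignI v [] (IAdd (var v) (INum 1)))"

lemma iarrays_For [simp]: "iarrays (For v lo e c) = insert v (iarrays c)"
  and sarrays_For [simp]: "sarrays (For v lo e c) = sarrays c"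
  by (auto simp: For_def)

text \<open>With a bound expression of cost 1, initialising \<open>v\<close> costs 2, a test 5 and
  an increment 4: hence 7 for the initialisation and the failing test, and \<open>T + 9\<close> per
  round. \<open>Suc n\<close> rounds is exact for loops from 0 and generous for loops from
  1.\<close>

definition for_time :: "nat \<Rightarrow> nat \<Rightarrow> nat" where
  "for_time n T = 7 + Suc n * (T + 9)"

text \<open>\<open>I m\<close> describes the state just before the round for \<open>m\<close>, when
  the counter already holds \<open>m\<close>; so \<open>I (Suc n)\<close> is the final claim. Each
  round may use the frame of the whole loop from the start state \<open>s\<close>, which spares the
  invariants everything that the loop does not write. \<open>lo \<le> Suc n\<close> admits empty
  loops.\<close>

lemma wp_For:
  assumes init: "I lo (set_int v [] lo s)"
    and step: "\<And>m s1. lo \<le> m \<Longrightarrow> m \<le> n \<Longrightarrow> ints s1 v [] = m \<Longrightarrow> frame (For v lo e c) s s1 \<Longrightarrow> I m s1 \<Longrightarrow>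
      wp p \<sigma> \<tau> c s1 (\<lambda>t s2. t \<le> T \<and> I (Suc m) (set_int v [] (Suc m) s2))"
    and n: "ival s e = n" and v: "v \<notin> iarrays c" and e: "ivars e \<inter> insert v (iarrays c) = {}"
    and lo: "lo \<le> Suc n" and cost: "icost e = 1"
  shows "wp p \<sigma> \<tau> (For v lo e c) s
    (\<lambda>t s'. t \<le> for_time n T \<and> I (Suc n) s' \<and> frame (For v lo e c) s s')"
proof -
  let ?J = "\<lambda>s'. \<exists>m. lo \<le> m \<and> m \<le> Suc n \<and> ints s' v [] = m \<and> I m s' \<and> frame (For v lo e c) s s'"
  have ev: "ival s' e = n" if "frame (For v lo e c) s s'" for s'
  proof -
    have "ival s' e = ival s e"
      using e that by (intro ival_cong) (auto simp: frame_def)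
    with n show ?thesis by simp
  qed
  have "wp p \<sigma> \<tau> (While (BNot (ILess e (var v))) (c ;; AssignI v [] (IAdd (var v) (INum 1))))
      (set_int v [] lo s)
    (\<lambda>t s'. t \<le> 1 + bcost (BNot (ILess e (var v))) +
        Suc n * (1 + bcost (BNot (ILess e (var v))) + (T + 4)) \<and> ?J s' \<and>
       \<not> bval s' (BNot (ILess e (var v))))"
  proof (rule wp_While[where f = "\<lambda>s. Suc n - ints s v []"])
    fix s1
    assume J: "?J s1" and b: "bval s1 (BNot (ILess e (var v)))"
    then obtain m where m: "lo \<le> m" "m \<le> n" "ints s1 v [] = m" "I m s1" "frame (For v lo e c) s s1"
      using ev by auto
    have "wp p \<sigma> \<tau> c s1 (\<lambda>t s2. (t \<le> T \<and> I (Suc m) (set_int v [] (Suc m) s2)) \<and> frame c s1 s2)"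
      using step m by (intro wp_frame) auto
    then show "wp p \<sigma> \<tau> (c ;; AssignI v [] (IAdd (var v) (INum 1))) s1
        (\<lambda>t s'. t \<le> T + 4 \<and> ?J s' \<and> Suc n - ints s' v [] < Suc n - ints s1 v [])"
      using m v unfolding wp_Seq
      by (elim wp_mono) (auto simp: frame_def set_int_def)
  next
    show "?J (set_int v [] lo s)"
      using lo init by (auto simp: frame_def set_int_def)
  qed (use lo in auto)
  then have "wp p \<sigma> \<tau> (While (BNot (ILess e (var v))) (c ;; AssignI v [] (IAdd (var v) (INum 1))))
      (set_int v [] lo s)
    (\<lambda>t s'. 2 + t \<le> for_time n T \<and> I (Suc n) s' \<and> frame (For v lo e c) s s')"
  proof (rule wp_mono, elim conjE exE)
    fix t s' m
    assume "t \<le> 1 + bcost (BNot (ILess e (var v))) +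
        Suc n * (1 + bcost (BNot (ILess e (var v))) + (T + 4))"
      and "\<not> bval s' (BNot (ILess e (var v)))" "m \<le> Suc n" "ints s' v [] = m" "I m s'"
        "frame (For v lo e c) s s'"
    moreover from this have "m = Suc n"
      using ev by auto
    ultimately show "2 + t \<le> for_time n T \<and> I (Suc n) s' \<and> frame (For v lo e c) s s'"
      using cost by (simp add: for_time_def algebra_simps)
  qed
  then show ?thesis
    unfolding For_def[of v lo e c] by (simp add: For_def[symmetric])
qed

section \<open>Matchings among the optimal graphs\<close>

lemma best_score_ge:
  assumes "finite U" "Pa \<subseteq> U" "card Pa \<le> k"
  shows "\<sigma> i Pa \<le> best_score k \<sigma> i U"
proof -
  have "finite {\<sigma> i Pa | Pa. Pa \<subseteq> U \<and> card Pa \<le> k}"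
    using assms(1) by simp
  with assms show ?thesis
    unfolding best_score_def by (intro Max_ge) auto
qed

lemma best_score_attained:
  assumes "finite U"
  obtains Pa where "Pa \<subseteq> U" "card Pa \<le> k" "best_score k \<sigma> i U = \<sigma> i Pa"
proof -
  let ?S = "{\<sigma> i Pa | Pa. Pa \<subseteq> U \<and> card Pa \<le> k}"
  have "finite ?S"
    using assms by simp
  \<comment> \<open>The empty set is allowed for every \<open>k\<close>, so the maximum is never
    taken over nothing.\<close>
  moreover have "\<sigma> i {} \<in> ?S"
    by (intro CollectI exI[of _ "{}"]) simp
  ultimately have "Max ?S \<in> ?S"
    by (intro Max_in) auto
  then show ?thesis
    using that unfolding best_score_def by blast
qed

lemma best_score_eqI:
  assumes "finite U" "Pa \<subseteq> U" "card Pa \<le> k"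
    and "\<And>Q. Q \<subseteq> U \<Longrightarrow> card Q \<le> k \<Longrightarrow> \<sigma> i Q \<le> \<sigma> i Pa"
  shows "best_score k \<sigma> i U = \<sigma> i Pa"
  using best_score_ge[OF assms(1-3), of \<sigma> i] best_score_attained[OF assms(1), of k \<sigma> i] assms(4)
  by (metis order_antisym)

lemma best_score_mono:
  assumes "finite W" "U \<subseteq> W"
  shows "best_score k \<sigma> i U \<le> best_score k \<sigma> i W"
proof -
  obtain Pa where "Pa \<subseteq> U" "card Pa \<le> k" "best_score k \<sigma> i U = \<sigma> i Pa"
    using best_score_attained[OF finite_subset[OF assms(2,1)]] .
  then show ?thesis
    using assms by (auto intro: best_score_ge)
qed

lemma best_score_empty: "best_score k \<sigma> i {} = \<sigma> i {}"
  by (intro best_score_eqI) auto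

lemma best_score_singleton:
  "best_score k \<sigma> i {j} = (if k = 0 then \<sigma> i {} else max (\<sigma> i {}) (\<sigma> i {j}))"
proof (cases "k = 0")
  case True
  have "best_score k \<sigma> i {j} = \<sigma> i {}"
    using True by (intro best_score_eqI) (auto simp: subset_singleton_iff)
  with True show ?thesis
    by simp
next
  case False
  then have "{\<sigma> i Pa | Pa. Pa \<subseteq> {j} \<and> card Pa \<le> k} = {\<sigma> i {}, \<sigma> i {j}}"
    by (auto simp: subset_singleton_iff)
  with False show ?thesis
    by (simp add: best_score_def)
qed

text \<open>The equations appear as inequalities: the other direction is monotonicity of
  \<open>best_score\<close>, so that the program decides each of them by one comparison.\<close>

definition matching_conditions :: "nat \<Rightarrow> nat \<Rightarrow> local_score \<Rightarrow> nat \<Rightarrow> bool" where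
  "matching_conditions k p \<sigma> i \<longleftrightarrow>
     (\<forall>j\<in>nodes p - {i}. best_score k \<sigma> i {} < best_score k \<sigma> i {j} \<longrightarrow>
        best_score k \<sigma> i (nodes p - {i, j}) \<le> best_score k \<sigma> i {} \<and>
        best_score k \<sigma> i (nodes p - {i}) \<le> best_score k \<sigma> i {j}) \<and>
     ((\<forall>j\<in>nodes p - {i}. best_score k \<sigma> i {j} \<le> best_score k \<sigma> i {}) \<longrightarrow>
        best_score k \<sigma> i (nodes p - {i}) \<le> best_score k \<sigma> i {})"

text \<open>Orienting every edge from the smaller to the larger label makes acyclicity immediate; by
  score equivalence the orientation does not affect the score.\<close>

definition candidate :: "nat \<Rightarrow> nat \<Rightarrow> local_score \<Rightarrow> (nat \<times> nat) set" where
  "candidate k p \<sigma> =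
     {(j, i) \<in> nodes p \<times> nodes p. j < i \<and> best_score k \<sigma> i {} < best_score k \<sigma> i {j}}"

lemma dag_parents:
  assumes "dag p E"
  shows "parents E i \<subseteq> nodes p - {i}"
  using assms by (auto simp: dag_def parents_def acyclic_def)

lemma dag_antisym: "dag p E \<Longrightarrow> (i, j) \<in> E \<Longrightarrow> (j, i) \<notin> E"
  unfolding dag_def acyclic_def by (meson trancl.intros)

lemma candidate_optimal:
  assumes equiv: "pairwise_score_equivalent p \<sigma>"
    and cond: "\<forall>i\<in>nodes p. matching_conditions k p \<sigma> i"
  shows "optimal_dag k p \<sigma> (candidate k p \<sigma>)" "matching_dag p (candidate k p \<sigma>)"
proof -
  define s where "s = best_score k \<sigma>"
  define R where "R i j \<longleftrightarrow> i \<in> nodes p \<and> j \<in> nodes p \<and> i \<noteq> j \<and> s i {} < s i {j}" for i j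
  let ?E = "candidate k p \<sigma>"
  have mem: "(j, i) \<in> ?E \<longleftrightarrow> j < i \<and> R i j" for i j
    by (auto simp: candidate_def R_def s_def)
  \<comment> \<open>With \<open>k = 0\<close> no singleton is an allowed parent set and no gain is
    possible.\<close>
  have k: "k \<noteq> 0" if "R i j" for i j
    using that by (auto simp: R_def s_def best_score_empty best_score_singleton split: if_splits)
  have single: "s i {j} = \<sigma> i {j}" if "R i j" for i j
    using that k[OF that] by (auto simp: R_def s_def best_score_empty best_score_singleton)
  \<comment> \<open>The gain is the positive part of \<open>\<sigma> i {j} - \<sigma> i {}\<close>,
    a difference that score equivalence makes symmetric in \<open>i\<close> and
    \<open>j\<close>.\<close>
  have sym: "R j i \<and> \<sigma> i {j} + \<sigma> j {} = \<sigma> j {i} + \<sigma> i {}" if "R i j" for i j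
  proof -
    have "\<sigma> i {j} + \<sigma> j {} = \<sigma> j {i} + \<sigma> i {}"
      using that equiv by (auto simp: R_def pairwise_score_equivalent_def)
    then show ?thesis
      using that k[OF that] by (auto simp: R_def s_def best_score_empty best_score_singleton)
  qed
  have R1: "s i (nodes p - {i, j}) \<le> s i {} \<and> s i (nodes p - {i}) \<le> s i {j}" if "R i j" for i j
    using that cond by (auto simp: R_def s_def matching_conditions_def)
  \<comment> \<open>A second partner \<open>j'\<close> would lie in \<open>nodes p - {i, j}\<close>,
    from which \<open>i\<close> can draw no more than its score without parents.\<close>
  have uniq: "j = j'" if "R i j" "R i j'" for i j j'
  proof (rule ccontr)
    assume "j \<noteq> j'"
    then have "s i {j'} \<le> s i (nodes p - {i, j})"
      using that unfolding s_def by (intro best_score_mono) (auto simp: R_def)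
    with R1[OF that(1)] that(2) show False
      by (auto simp: R_def)
  qed
  have E: "?E \<subseteq> nodes p \<times> nodes p"
    by (auto simp: candidate_def)
  have "acyclic ?E"
    by (rule acyclic_subset[of less_than]) (auto simp: mem wf_acyclic)
  with E have dag: "dag p ?E"
    by (simp add: dag_def)
  show "matching_dag p ?E"
    unfolding matching_dag_def
  proof (intro conjI ballI dag)
    fix i
    have "{j. (i, j) \<in> ?E \<or> (j, i) \<in> ?E} \<subseteq> {j. R i j}"
      using sym by (auto simp: mem)
    moreover have "\<exists>j0. {j. R i j} \<subseteq> {j0}"
      using uniq by blast
    ultimately obtain j0 where "{j. (i, j) \<in> ?E \<or> (j, i) \<in> ?E} \<subseteq> {j0}"
      by blast
    then show "card {j. (i, j) \<in> ?E \<or> (j, i) \<in> ?E} \<le> 1"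
      using card_mono[of "{j0}"] by fastforce
  qed
  \<comment> \<open>\<open>m\<close> sends a node to its partner and an unmatched node to itself. As
    an involution it turns twice a sum over the nodes into a sum over pairs, in which an unmatched
    node is paired with itself.\<close>
  define m where "m i = (if \<exists>j. R i j then THE j. R i j else i)" for i
  have m: "m i = j" if "R i j" for i j
    using that uniq unfolding m_def by auto
  have m_id: "m i = i" if "\<nexists>j. R i j" for i
    using that by (simp add: m_def)
  have m_nodes: "m i \<in> nodes p" if "i \<in> nodes p" for i
    by (cases "\<exists>j. R i j") (use that m m_id in \<open>auto simp: R_def\<close>)
  have m_inv: "m (m i) = i" for i
    by (cases "\<exists>j. R i j") (use m m_id sym in auto)
  have bij: "bij_betw m (nodes p) (nodes p)"
    by (rule bij_betw_byWitness[of _ m]) (use m_nodes m_inv in auto)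
  have parE: "parents ?E i = (if \<exists>j. R i j \<and> j < i then {m i} else {})" for i
    using m by (auto simp: parents_def mem)
  have space: "?E \<in> search_space k p"
    using dag k by (auto simp: search_space_def parE Suc_le_eq)
  have "graph_score p \<sigma> E' \<le> graph_score p \<sigma> ?E" if E': "E' \<in> search_space k p" for E'
  proof -
    define f where "f i = \<sigma> i (parents E' i)" for i
    define g where "g i = \<sigma> i (parents ?E i)" for i
    have dag': "dag p E'"
      using E' by (simp add: search_space_def)
    have f_le: "f i \<le> s i U" if "i \<in> nodes p" "parents E' i \<subseteq> U" "finite U" for i U
      using that E' unfolding f_def s_def search_space_def by (intro best_score_ge) auto
    have f1: "f i \<le> s i (nodes p - {i})" if "i \<in> nodes p" for i
      using that dag_parents[OF dag'] by (intro f_le) auto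
    have f2: "f i \<le> s i {}" if "R i j" "j \<notin> parents E' i" for i j
    proof -
      have "f i \<le> s i (nodes p - {i, j})"
        using that dag_parents[OF dag'] by (intro f_le) (auto simp: R_def)
      with R1[OF that(1)] show ?thesis
        by simp
    qed
    have pair: "f i + f (m i) \<le> g i + g (m i)" if i: "i \<in> nodes p" for i
    proof (cases "\<exists>j. R i j")
      case False
      then have "\<forall>j\<in>nodes p - {i}. s i {j} \<le> s i {}"
        using i by (force simp: R_def)
      then have "s i (nodes p - {i}) \<le> s i {}"
        using i cond by (auto simp: s_def matching_conditions_def)
      moreover have "g i = s i {}"
        using False by (simp add: g_def parE s_def best_score_empty)
      ultimately show ?thesis
        using m_id[OF False] f1[OF i] by simp
    next
      case True
      then obtain j where R: "R i j" by blast
      note R' = conjunct1[OF sym[OF R]]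
      have j: "m i = j" "m j = i"
        using R R' m by auto
      have g: "g i + g j = \<sigma> i {j} + \<sigma> j {}"
      proof (cases "j < i")
        case True
        then have "\<nexists>i'. R j i' \<and> i' < j"
          using uniq[OF R'] by force
        with True R j show ?thesis
          by (auto simp: g_def parE)
      next
        case False
        then have "\<nexists>j'. R i j' \<and> j' < i"
          using uniq[OF R] by force
        moreover have "i < j"
          using False R by (auto simp: R_def)
        ultimately show ?thesis
          using R R' j sym[OF R] by (auto simp: g_def parE)
      qed
      \<comment> \<open>The endpoint that lacks the other as a parent gets at most its score without
        parents; the other endpoint gets at most its score with the partner as sole parent. Score
        equivalence gives both cases the same bound.\<close>
      have "j \<notin> parents E' i \<or> i \<notin> parents E' j"
        using dag_antisym[OF dag'] by (auto simp: parents_def)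
      then have "f i + f j \<le> \<sigma> i {j} + \<sigma> j {}"
      proof
        assume "j \<notin> parents E' i"
        then have "f i \<le> \<sigma> i {}"
          using f2[OF R] by (simp add: s_def best_score_empty)
        moreover have "f j \<le> \<sigma> j {i}"
          using f1[of j] R1[OF R'] single[OF R'] R by (auto simp: R_def)
        ultimately show ?thesis
          using sym[OF R] by linarith
      next
        assume "i \<notin> parents E' j"
        then have "f j \<le> \<sigma> j {}"
          using f2[OF R'] by (simp add: s_def best_score_empty)
        moreover have "f i \<le> \<sigma> i {j}"
          using f1[of i] R1[OF R] single[OF R] R by (auto simp: R_def)
        ultimately show ?thesis
          by linarith
      qed
      with g j show ?thesis
        by simp
    qed
    have double: "2 * sum h (nodes p) = (\<Sum>i\<in>nodes p. h i + h (m i))" for h :: "nat \<Rightarrow> real"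
      using sum.reindex_bij_betw[OF bij, of h] by (simp add: sum.distrib)
    have "2 * sum f (nodes p) \<le> 2 * sum g (nodes p)"
      unfolding double by (intro sum_mono pair)
    then show ?thesis
      by (simp add: graph_score_def f_def g_def)
  qed
  with space show "optimal_dag k p \<sigma> ?E"
    by (simp add: optimal_dag_def)
qed

section \<open>Changing the parents of one node in an optimal graph\<close>

lemma acyclic_Un_Times:
  assumes "acyclic r" and "\<And>q. q \<in> Q \<Longrightarrow> (i, q) \<notin> r\<^sup>*"
  shows "acyclic (r \<union> Q \<times> {i})"
proof -
  \<comment> \<open>Only the ends of a path through new edges are recorded: before its first new
    edge it runs in \<open>r\<close> to some \<open>q\<close> in \<open>Q\<close>, after its last
    one it runs in \<open>r\<close> from \<open>i\<close>. For a closed path the two ends join to a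
    forbidden path from \<open>i\<close> to \<open>q\<close>.\<close>
  have *: "(a, b) \<in> r\<^sup>+ \<or> ((i, b) \<in> r\<^sup>* \<and> (\<exists>q\<in>Q. (a, q) \<in> r\<^sup>*))"
    if "(a, b) \<in> (r \<union> Q \<times> {i})\<^sup>+" for a b
    using that
  proof (induction rule: trancl_induct)
    case (base b)
    then show ?case by auto
  next
    case (step b c)
    then show ?case
      by (auto intro: trancl_into_trancl rtrancl_into_rtrancl dest: trancl_into_rtrancl)
  qed
  have "(a, a) \<notin> (r \<union> Q \<times> {i})\<^sup>+" for a
    using *[of a a] assms by (meson acyclic_def rtrancl_trans)
  then show ?thesis
    by (simp add: acyclic_def)
qed

lemma graph_score_replace_parents:
  assumes "i \<in> nodes p"
  shows "graph_score p \<sigma> {(a, b). if b = i then a \<in> Q else (a, b) \<in> E} =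
    graph_score p \<sigma> E - \<sigma> i (parents E i) + \<sigma> i Q"
proof -
  let ?E = "{(a, b). if b = i then a \<in> Q else (a, b) \<in> E}"
  have par: "parents ?E b = (if b = i then Q else parents E b)" for b
    by (auto simp: parents_def)
  have "(\<Sum>b\<in>nodes p - {i}. \<sigma> b (parents ?E b)) = (\<Sum>b\<in>nodes p - {i}. \<sigma> b (parents E b))"
    by (intro sum.cong) (auto simp: par)
  moreover have "sum h (nodes p) = h i + sum h (nodes p - {i})" for h :: "nat \<Rightarrow> real"
    using assms by (intro sum.remove) auto
  ultimately show ?thesis
    unfolding graph_score_def by (simp only: par) simp
qed

text \<open>The new graph arises by deleting the edges into \<open>i\<close> and adding those from
  \<open>Q\<close>. In what remains after the deletion \<open>i\<close> reaches no element of
  \<open>Q\<close>, so no added edge closes a cycle.\<close>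

lemma replace_parents_search_space:
  assumes E: "E \<in> search_space k p" and i: "i \<in> nodes p"
    and Q: "Q \<subseteq> nodes p" "card Q \<le> k" "\<And>q. q \<in> Q \<Longrightarrow> (i, q) \<notin> {(a, b) \<in> E. b \<noteq> i}\<^sup>*"
  shows "{(a, b). if b = i then a \<in> Q else (a, b) \<in> E} \<in> search_space k p" (is "?E \<in> _")
proof -
  have dagE: "E \<subseteq> nodes p \<times> nodes p" "acyclic E"
    using E by (auto simp: search_space_def dag_def)
  have "?E = {(a, b) \<in> E. b \<noteq> i} \<union> Q \<times> {i}"
    by (auto split: if_splits)
  moreover have "acyclic {(a, b) \<in> E. b \<noteq> i}"
    by (rule acyclic_subset[OF dagE(2)]) auto
  ultimately have "acyclic ?E"
    using acyclic_Un_Times[of "{(a, b) \<in> E. b \<noteq> i}" Q i] Q(3) by simp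
  moreover have "?E \<subseteq> nodes p \<times> nodes p"
    using dagE(1) i Q(1) by (auto split: if_splits)
  moreover have "parents ?E b = (if b = i then Q else parents E b)" for b
    by (auto simp: parents_def)
  ultimately show ?thesis
    using E Q(2) by (auto simp: search_space_def dag_def)
qed

text \<open>Exchange argument: the altered graph competes with \<open>E\<close>, and the two scores
  differ only in the local score of \<open>i\<close>.\<close>

lemma optimal_replace_parents:
  assumes E: "optimal_dag k p \<sigma> E" and i: "i \<in> nodes p"
    and Q: "Q \<subseteq> nodes p" "card Q \<le> k" "\<And>q. q \<in> Q \<Longrightarrow> (i, q) \<notin> {(a, b) \<in> E. b \<noteq> i}\<^sup>*"
  shows "\<sigma> i Q \<le> \<sigma> i (parents E i)"
proof -
  have "graph_score p \<sigma> {(a, b). if b = i then a \<in> Q else (a, b) \<in> E} \<le> graph_score p \<sigma> E"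
    using E replace_parents_search_space[OF _ i Q] by (simp add: optimal_dag_def)
  then show ?thesis
    by (simp add: graph_score_replace_parents[OF i])
qed

lemma matching_unique:
  assumes "matching_dag p E" "(a, b) \<in> E \<or> (b, a) \<in> E" "(a, c) \<in> E \<or> (c, a) \<in> E"
  shows "b = c"
proof -
  let ?N = "{j. (a, j) \<in> E \<or> (j, a) \<in> E}"
  have "a \<in> nodes p" "?N \<subseteq> nodes p"
    using assms by (auto simp: matching_dag_def dag_def)
  then have "card ?N \<le> Suc 0" "finite ?N"
    using assms finite_subset[of ?N "nodes p"] by (auto simp: matching_dag_def)
  then have "\<forall>x\<in>?N. \<forall>y\<in>?N. x = y"
    using card_le_Suc0_iff_eq by blast
  with assms(2,3) show ?thesis
    by blast
qed

lemma matching_parents: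
  assumes "matching_dag p E" "(a, b) \<in> E"
  shows "parents E b = {a}" "parents E a = {}" "{c. (b, c) \<in> E} = {}" "{c. (a, c) \<in> E} = {b}"
  using assms matching_unique[OF assms(1)] dag_antisym[of p E a b]
  unfolding parents_def matching_dag_def by blast+

text \<open>The reversal consists of two changes of a single parent set: \<open>M1\<close> empties
  the parents of \<open>b\<close>, \<open>M2\<close> makes \<open>b\<close> the parent of
  \<open>a\<close>. Both graphs stay in the search space, and the two changes of the score cancel by
  score equivalence.\<close>

lemma optimal_matching_reverse:
  assumes equiv: "pairwise_score_equivalent p \<sigma>"
    and M: "optimal_dag k p \<sigma> M" "matching_dag p M" and ab: "(a, b) \<in> M"
  obtains M' where "optimal_dag k p \<sigma> M'" "matching_dag p M'" "(b, a) \<in> M'"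
proof -
  have nodes: "a \<in> nodes p" "b \<in> nodes p" "a \<noteq> b"
    using M(2) ab dag_antisym[of p M a b] by (auto simp: matching_dag_def dag_def)
  note par = matching_parents[OF M(2) ab]
  define M1 where "M1 = {(x, y). if y = b then x \<in> {} else (x, y) \<in> M}"
  define M2 where "M2 = {(x, y). if y = a then x \<in> {b} else (x, y) \<in> M1}"
  have M_space: "M \<in> search_space k p"
    using M by (simp add: optimal_dag_def)
  then have "card (parents M b) \<le> k"
    using nodes(2) by (simp add: search_space_def)
  \<comment> \<open>That \<open>a\<close> may have a parent at all follows from \<open>b\<close>
    already having one.\<close>
  then have k: "k \<ge> 1"
    by (simp add: par(1))
  have M1_space: "M1 \<in> search_space k p"
    unfolding M1_def by (rule replace_parents_search_space[OF M_space nodes(2)]) auto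
  \<comment> \<open>The only edge of \<open>M\<close> that leaves \<open>a\<close> leads to
    \<open>b\<close> and is absent from \<open>M1\<close>.\<close>
  have "(a, b) \<notin> {(x, y) \<in> M1. y \<noteq> a}\<^sup>*"
  proof
    assume "(a, b) \<in> {(x, y) \<in> M1. y \<noteq> a}\<^sup>*"
    then show False
      by (rule converse_rtranclE) (use par(4) nodes in \<open>auto simp: M1_def split: if_splits\<close>)
  qed
  then have M2_space: "M2 \<in> search_space k p"
    unfolding M2_def using k nodes by (intro replace_parents_search_space[OF M1_space]) auto
  have "parents M1 a = parents M a"
    using nodes by (auto simp: parents_def M1_def)
  then have "graph_score p \<sigma> M2 = graph_score p \<sigma> M - \<sigma> b {a} + \<sigma> b {} - \<sigma> a {} + \<sigma> a {b}"
    using par nodes unfolding M2_def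
    by (simp add: graph_score_replace_parents M1_def del: insert_iff empty_iff)
  also have "\<dots> = graph_score p \<sigma> M"
    using equiv[unfolded pairwise_score_equivalent_def, rule_format, OF nodes] by simp
  finally have "optimal_dag k p \<sigma> M2"
    using M M2_space by (simp add: optimal_dag_def)
  moreover have M2_eq: "M2 = insert (b, a) (M - {(a, b)})"
    using par nodes by (auto simp: M2_def M1_def parents_def)
  have "{j. (i, j) \<in> M2 \<or> (j, i) \<in> M2} = {j. (i, j) \<in> M \<or> (j, i) \<in> M}" for i
    using ab by (auto simp: M2_eq)
  then have "matching_dag p M2"
    using M(2) M2_space by (simp add: matching_dag_def search_space_def)
  ultimately show ?thesis
    using that M2_eq by blast
qed

lemma best_score_le_parents:
  assumes E: "optimal_dag k p \<sigma> E" and i: "i \<in> nodes p" and U: "U \<subseteq> nodes p"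
    and reach: "\<And>q. q \<in> U \<Longrightarrow> (i, q) \<notin> {(a, b) \<in> E. b \<noteq> i}\<^sup>*"
  shows "best_score k \<sigma> i U \<le> \<sigma> i (parents E i)"
proof -
  obtain Q where Q: "Q \<subseteq> U" "card Q \<le> k" "best_score k \<sigma> i U = \<sigma> i Q"
    using best_score_attained[OF finite_subset[OF U finite_atLeastAtMost]] .
  then show ?thesis
    using optimal_replace_parents[OF E i, of Q] U reach by auto
qed

text \<open>A sink reaches no other node, so it may be given any allowed parent set: this is the
  move to the end of a topological order.\<close>

lemma best_score_le_sink:
  assumes "optimal_dag k p \<sigma> E" "i \<in> nodes p" "{c. (i, c) \<in> E} = {}"
  shows "best_score k \<sigma> i (nodes p - {i}) \<le> \<sigma> i (parents E i)"
proof (rule best_score_le_parents[OF assms(1,2)])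
  fix q
  assume "q \<in> nodes p - {i}"
  then show "(i, q) \<notin> {(a, b) \<in> E. b \<noteq> i}\<^sup>*"
    using assms(3) by (auto elim: converse_rtranclE)
qed auto

text \<open>An edge of the matching is used in both orientations, which reversal supplies. As
  \<open>(j, i)\<close> it makes \<open>i\<close> a sink, free to take parents from
  \<open>nodes p - {i}\<close>; as \<open>(i, j)\<close> it leaves only \<open>j\<close> reachable
  from \<open>i\<close>, which is then free to take parents from
  \<open>nodes p - {i, j}\<close>.\<close>

lemma optimal_matching_conditions:
  assumes equiv: "pairwise_score_equivalent p \<sigma>"
    and M: "optimal_dag k p \<sigma> M" "matching_dag p M" and i: "i \<in> nodes p"
  shows "matching_conditions k p \<sigma> i"
proof -
  define s where "s = best_score k \<sigma>"
  have lower: "s i {j} \<le> s i (nodes p - {i})" if "j \<in> nodes p - {i}" for j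
    using that unfolding s_def by (intro best_score_mono) auto
  \<comment> \<open>By monotonicity no edge at \<open>i\<close> then has a positive gain.\<close>
  have trivial: ?thesis if "s i (nodes p - {i}) \<le> s i {}"
    unfolding matching_conditions_def using lower that by (force simp: s_def)
  show ?thesis
  proof (cases "\<exists>j. (i, j) \<in> M \<or> (j, i) \<in> M")
    case False
    then have "s i (nodes p - {i}) \<le> \<sigma> i (parents M i)" "parents M i = {}"
      unfolding s_def using best_score_le_sink[OF M(1) i] by (auto simp: parents_def)
    then show ?thesis
      by (intro trivial) (simp add: s_def best_score_empty)
  next
    case True
    then obtain j where "(i, j) \<in> M \<or> (j, i) \<in> M"
      by blast
    then obtain M1 M2 where
      M1: "optimal_dag k p \<sigma> M1" "matching_dag p M1" "(j, i) \<in> M1" and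
      M2: "optimal_dag k p \<sigma> M2" "matching_dag p M2" "(i, j) \<in> M2"
      using M optimal_matching_reverse[OF equiv M] by metis
    note par1 = matching_parents[OF M1(2,3)] and par2 = matching_parents[OF M2(2,3)]
    have j: "j \<in> nodes p" "j \<noteq> i"
      using M1(2,3) dag_antisym[of p M1 j i] by (auto simp: matching_dag_def dag_def)
    have "card (parents M1 i) \<le> k"
      using M1(1) i by (simp add: optimal_dag_def search_space_def)
    then have single: "s i {j} = max (\<sigma> i {}) (\<sigma> i {j})"
      by (auto simp: par1(1) s_def best_score_singleton)
    have sink: "s i (nodes p - {i}) \<le> \<sigma> i {j}"
      unfolding s_def using best_score_le_sink[OF M1(1) i par1(3)] par1(1) by simp
    have source: "s i (nodes p - {i, j}) \<le> s i {}"
    proof -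
      have "(i, q) \<notin> {(a, b) \<in> M2. b \<noteq> i}\<^sup>*" if "q \<in> nodes p - {i, j}" for q
      proof
        assume "(i, q) \<in> {(a, b) \<in> M2. b \<noteq> i}\<^sup>*"
        then have "q = i \<or> q = j"
          by (induction rule: rtrancl_induct) (use par2 in auto)
        with that show False
          by simp
      qed
      then have "s i (nodes p - {i, j}) \<le> \<sigma> i (parents M2 i)"
        unfolding s_def by (intro best_score_le_parents[OF M2(1) i]) auto
      with par2 show ?thesis
        by (simp add: s_def best_score_empty)
    qed
    show ?thesis
    \<comment> \<open>An optimal matching may contain an edge without gain; the conditions then
      treat \<open>i\<close> like an unmatched node.\<close>
    proof (cases "s i {j} \<le> s i {}")
      case True
      then show ?thesis
        using sink single by (intro trivial) (simp add: s_def best_score_empty)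
    next
      case False
      have "j' = j" if "j' \<in> nodes p - {i}" "s i {} < s i {j'}" for j'
      proof (rule ccontr)
        assume "j' \<noteq> j"
        with that have "s i {j'} \<le> s i (nodes p - {i, j})"
          unfolding s_def by (intro best_score_mono) auto
        with source that show False
          by simp
      qed
      moreover have "s i (nodes p - {i}) \<le> s i {j}"
        using sink single by simp
      ultimately show ?thesis
        using source False j unfolding matching_conditions_def s_def by blast
    qed
  qed
qed

section \<open>Graphs from rankings of the nodes\<close>

text \<open>Ranks need not be distinct; nodes of equal rank merely cannot be parents of each other.
  Any sequence of digits is thus a usable ranking, and permutations need not be singled out.\<close>

definition ranking_score :: "nat \<Rightarrow> nat \<Rightarrow> local_score \<Rightarrow> (nat \<Rightarrow> nat) \<Rightarrow> real" where
  "ranking_score k p \<sigma> r = (\<Sum>i\<in>nodes p. best_score k \<sigma> i {j \<in> nodes p. r j < r i})"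

text \<open>Count ancestors: along an edge, the tail and all its ancestors are ancestors of the
  head, while by acyclicity the tail is not its own ancestor. The bound \<open>p\<close> makes the
  ranks digits in base \<open>p + 1\<close>.\<close>

lemma dag_ranking:
  assumes "dag p E"
  obtains r where "\<And>j i. (j, i) \<in> E \<Longrightarrow> r j < (r i :: nat)" "\<And>i. r i \<le> p"
proof -
  define r where "r i = card {j. (j, i) \<in> E\<^sup>+}" for i
  have sub: "{j. (j, i) \<in> E\<^sup>+} \<subseteq> nodes p" for i
    using assms trancl_subset_Sigma[of E "nodes p"] by (auto simp: dag_def)
  have "r j < r i" if "(j, i) \<in> E" for j i
    unfolding r_def
  proof (intro psubset_card_mono psubsetI)
    show "finite {j. (j, i) \<in> E\<^sup>+}"
      using sub finite_subset by blast
    show "{h. (h, j) \<in> E\<^sup>+} \<subseteq> {h. (h, i) \<in> E\<^sup>+}"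
      using that by (auto intro: trancl_into_trancl)
    show "{h. (h, j) \<in> E\<^sup>+} \<noteq> {h. (h, i) \<in> E\<^sup>+}"
      using that assms by (auto simp: dag_def acyclic_def set_eq_iff)
  qed
  moreover have "r i \<le> p" for i
    using card_mono[OF _ sub[of i]] by (simp add: r_def)
  ultimately show ?thesis
    using that by blast
qed

lemma graph_score_le_ranking_score:
  assumes "E \<in> search_space k p" "\<And>j i. (j, i) \<in> E \<Longrightarrow> r j < r i"
  shows "graph_score p \<sigma> E \<le> ranking_score k p \<sigma> r"
  unfolding graph_score_def ranking_score_def
  by (intro sum_mono best_score_ge)
    (use assms in \<open>auto simp: search_space_def dag_def parents_def\<close>)

lemma ranking_search_space:
  assumes "E \<subseteq> nodes p \<times> nodes p" "\<And>j i. (j, i) \<in> E \<Longrightarrow> r j < (r i :: nat)"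
    and "\<And>i. i \<in> nodes p \<Longrightarrow> card (parents E i) \<le> k"
  shows "E \<in> search_space k p"
proof -
  have "acyclic E"
    by (rule acyclic_subset[of "measure r"]) (use assms(2) in \<open>auto simp: wf_acyclic\<close>)
  with assms(1,3) show ?thesis
    by (simp add: search_space_def dag_def)
qed

text \<open>Digits are read lowest first and positions start at 1, hence the exponent
  \<open>l - 1\<close>. The number is built in Horner form as \<open>f 1 + b * m\<close>, where
  \<open>m\<close> carries the remaining digits.\<close>

lemma exists_digits:
  assumes "\<And>l. l \<in> {1..n} \<Longrightarrow> f l < b"
  shows "\<exists>m<b ^ n. \<forall>l\<in>{1..n}. m div b ^ (l - 1) mod b = (f l :: nat)"
  using assms
proof (induction n arbitrary: f)
  case (Suc n)
  have "f (Suc l) < b" if "l \<in> {1..n}" for l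
    using that Suc.prems by simp
  then obtain m where m: "m < b ^ n" "\<forall>l\<in>{1..n}. m div b ^ (l - 1) mod b = f (Suc l)"
    using Suc.IH[of "\<lambda>l. f (Suc l)"] by blast
  have f1: "f 1 < b"
    using Suc.prems by simp
  have "f 1 + b * m < b * Suc m"
    using f1 by simp
  also have "\<dots> \<le> b ^ Suc n"
    using m(1) by (simp only: power_Suc) (intro mult_le_mono, auto)
  finally have "f 1 + b * m < b ^ Suc n" .
  moreover have "(f 1 + b * m) div b ^ (l - 1) mod b = f l" if "l \<in> {1..Suc n}" for l
  proof (cases "l = 1")
    case True
    with f1 show ?thesis by simp
  next
    case False
    with that have l': "l = Suc (Suc (l - 2))"
      by auto
    have "b ^ (l - 1) = b * b ^ (l - 2)"
      by (subst l') simp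
    then have "(f 1 + b * m) div b ^ (l - 1) = (f 1 + b * m) div b div b ^ (l - 2)"
      by (simp add: div_mult2_eq)
    also have "(f 1 + b * m) div b = m"
      using f1 by simp
    finally have "(f 1 + b * m) div b ^ (l - 1) mod b = m div b ^ (l - 1 - 1) mod b"
      by (simp add: numeral_2_eq_2)
    also have "\<dots> = f (Suc (l - 1))"
      using that False by (intro m(2)[rule_format]) auto
    finally show ?thesis
      using that by simp
  qed
  ultimately show ?case
    by blast
qed simp

section \<open>Powers, digits and rows\<close>

text \<open>Multiplication by \<open>p + 1\<close> is done by \<open>p + 1\<close> additions; for
  this count the inner loop starts at 0.\<close>

definition power_com :: "iexp \<Rightarrow> string \<Rightarrow> com" where
  "power_com e x = AssignI x [] (INum 1) ;;
     For ''l'' 1 e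
       (AssignI ''t'' [] (INum 0) ;;
        For ''j'' 0 (var ''p'') (AssignI ''t'' [] (IAdd (var ''t'') (var x))) ;;
        AssignI x [] (var ''t''))"

lemma arrays_power_com [simp]:
  "iarrays (power_com e x) = {x, ''l'', ''t'', ''j''}" "sarrays (power_com e x) = {}"
  by (auto simp: power_com_def)

definition power_time :: "nat \<Rightarrow> nat \<Rightarrow> nat" where
  "power_time p n = 2 + for_time n (4 + for_time p 4)"

lemma wp_power_com:
  assumes p: "ints s ''p'' [] = p" and e: "ival s e = n" "icost e = 1" "ivars e \<subseteq> {''p''}"
    and x: "x \<notin> {''p'', ''l'', ''t'', ''j''}"
  shows "wp p \<sigma> \<tau> (power_com e x) s
    (\<lambda>t s'. t \<le> power_time p n \<and> ints s' x [] = Suc p ^ n \<and> frame (power_com e x) s s')"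
proof -
  let ?inner = "For ''j'' 0 (var ''p'') (AssignI ''t'' [] (IAdd (var ''t'') (var x)))"
  let ?body = "AssignI ''t'' [] (INum 0) ;; ?inner ;; AssignI x [] (var ''t'')"
  have inner: "wp p \<sigma> \<tau> ?inner s1
      (\<lambda>t s'. t \<le> for_time p 4 \<and> ints s' ''t'' [] = Suc p * ints s1 x [] \<and> frame ?inner s1 s')"
    if "ints s1 ''p'' [] = p" "ints s1 ''t'' [] = 0" for s1
    by (rule wp_For[where I = "\<lambda>m s'. ints s' ''t'' [] = m * ints s1 x []"])
      (use that x in \<open>auto simp: frame_def\<close>)
  have "wp p \<sigma> \<tau> (For ''l'' 1 e ?body) (set_int x [] 1 s)
      (\<lambda>t s'. t \<le> for_time n (4 + for_time p 4) \<and> ints s' x [] = Suc p ^ (Suc n - 1) \<and>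
         frame (For ''l'' 1 e ?body) (set_int x [] 1 s) s')"
  proof (rule wp_For[where I = "\<lambda>m s'. ints s' x [] = Suc p ^ (m - 1)"])
    fix m s1
    assume m: "1 \<le> m" "frame (For ''l'' 1 e ?body) (set_int x [] 1 s) s1" "ints s1 x [] = Suc p ^ (m - 1)"
    have "ints (set_int ''t'' [] 0 s1) ''p'' [] = p"
      using frame_ints[OF m(2), of "''p''" "[]"] p x by auto
    then have "wp p \<sigma> \<tau> ?inner (set_int ''t'' [] 0 s1)
      (\<lambda>t s'. t \<le> for_time p 4 \<and> ints s' ''t'' [] = Suc p * ints (set_int ''t'' [] 0 s1) x [] \<and>
         frame ?inner (set_int ''t'' [] 0 s1) s')"
      by (rule inner) simp
    moreover have "Suc p ^ m = Suc p * Suc p ^ (m - 1)"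
      using m(1) by (cases m) auto
    ultimately show "wp p \<sigma> \<tau> ?body s1
        (\<lambda>t s2. t \<le> 4 + for_time p 4 \<and> ints (set_int ''l'' [] (Suc m) s2) x [] = Suc p ^ (Suc m - 1))"
      using m x by (simp, elim wp_mono) auto
  next
    show "ival (set_int x [] 1 s) e = n"
      using e x by (subst ival_cong[of e _ s]) (auto simp: set_int_def)
  qed (use e x in auto)
  then show ?thesis
    unfolding power_com_def power_time_def wp_Seq wp_AssignI
    using x by simp (elim wp_mono, auto simp: frame_def set_int_def)
qed

definition digit :: "nat \<Rightarrow> nat \<Rightarrow> nat \<Rightarrow> nat" where
  "digit b m l = m div b ^ (l - 1) mod b"

text \<open>Division with remainder by repeated subtraction: once \<open>r\<close> has dropped to at
  most \<open>p\<close> it is the next digit, and \<open>q\<close>, which counts the subtractions,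
  becomes the number still to be decoded.\<close>

definition digits_com :: "string \<Rightarrow> iexp \<Rightarrow> string \<Rightarrow> com" where
  "digits_com x e d = AssignI ''r'' [] (var x) ;;
     For ''l'' 1 e
       (AssignI ''q'' [] (INum 0) ;;
        While (ILess (var ''p'') (var ''r''))
          (AssignI ''r'' [] (ISub (var ''r'') (IAdd (var ''p'') (INum 1))) ;;
           AssignI ''q'' [] (IAdd (var ''q'') (INum 1))) ;;
        AssignI d [var ''l''] (var ''r'') ;;
        AssignI ''r'' [] (var ''q''))"

lemma arrays_digits_com [simp]:
  "iarrays (digits_com x e d) = {''r'', ''l'', ''q'', d}" "sarrays (digits_com x e d) = {}"
  by (auto simp: digits_com_def)

text \<open>The 14 is a test and the two assignments of one subtraction, the 11 the failing test and
  the other assignments of a round. Bounding the number of subtractions by \<open>M\<close> is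
  crude, but codes of parent sets are polynomial anyway.\<close>

definition digits_time :: "nat \<Rightarrow> nat \<Rightarrow> nat" where
  "digits_time n M = 2 + for_time n (11 + 14 * M)"

lemma wp_digits_com:
  assumes p: "ints s ''p'' [] = p" and e: "ival s e = n" "icost e = 1" "ivars e \<subseteq> {''p''}"
    and d: "d \<notin> {''p'', ''r'', ''l'', ''q''}" and M: "ints s x [] \<le> M"
  shows "wp p \<sigma> \<tau> (digits_com x e d) s
    (\<lambda>t s'. t \<le> digits_time n M \<and> (\<forall>l\<in>{1..n}. ints s' d [l] = digit (Suc p) (ints s x []) l) \<and>
       frame (digits_com x e d) s s')"
proof -
  let ?N = "ints s x []"
  let ?loop = "While (ILess (var ''p'') (var ''r''))
          (AssignI ''r'' [] (ISub (var ''r'') (IAdd (var ''p'') (INum 1))) ;;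
           AssignI ''q'' [] (IAdd (var ''q'') (INum 1)))"
  let ?body = "AssignI ''q'' [] (INum 0) ;; ?loop ;; AssignI d [var ''l''] (var ''r'') ;;
    AssignI ''r'' [] (var ''q'')"
  let ?I = "\<lambda>m s'. ints s' ''r'' [] = ?N div Suc p ^ (m - 1) \<and>
    (\<forall>l\<in>{1..<m}. ints s' d [l] = digit (Suc p) ?N l)"
  have loop: "wp p \<sigma> \<tau> ?loop s1
      (\<lambda>t s'. t \<le> 4 + 14 * M \<and> ints s' ''r'' [] = ints s1 ''r'' [] mod Suc p \<and>
         ints s' ''q'' [] = ints s1 ''r'' [] div Suc p \<and> frame ?loop s1 s')"
    if s1: "ints s1 ''p'' [] = p" "ints s1 ''q'' [] = 0" "ints s1 ''r'' [] \<le> M" for s1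
  proof -
    let ?R = "ints s1 ''r'' []"
    have "wp p \<sigma> \<tau> ?loop s1
      (\<lambda>t s'. t \<le> 1 + bcost (ILess (var ''p'') (var ''r'')) + M * (1 + bcost (ILess (var ''p'') (var ''r'')) + 10) \<and>
        (ints s' ''r'' [] + ints s' ''q'' [] * Suc p = ?R \<and> ints s' ''p'' [] = p) \<and>
        \<not> bval s' (ILess (var ''p'') (var ''r'')))"
    proof (rule wp_While[where f = "\<lambda>s'. ints s' ''r'' []"])
      fix s2
      assume "ints s2 ''r'' [] + ints s2 ''q'' [] * Suc p = ?R \<and> ints s2 ''p'' [] = p"
        and "bval s2 (ILess (var ''p'') (var ''r''))"
      then show "wp p \<sigma> \<tau> (AssignI ''r'' [] (ISub (var ''r'') (IAdd (var ''p'') (INum 1))) ;;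
           AssignI ''q'' [] (IAdd (var ''q'') (INum 1))) s2
         (\<lambda>t s'. t \<le> 10 \<and> (ints s' ''r'' [] + ints s' ''q'' [] * Suc p = ?R \<and> ints s' ''p'' [] = p) \<and>
            ints s' ''r'' [] < ints s2 ''r'' [])"
        by auto
    qed (use s1 in auto)
    then have "wp p \<sigma> \<tau> ?loop s1
      (\<lambda>t s'. t \<le> 4 + 14 * M \<and> ints s' ''r'' [] = ?R mod Suc p \<and> ints s' ''q'' [] = ?R div Suc p)"
    proof (rule wp_mono, goal_cases)
      case (1 t s')
      then have "ints s' ''r'' [] < Suc p" "?R = ints s' ''r'' [] + Suc p * ints s' ''q'' []"
        by (auto simp: mult.commute)
      then have "?R mod Suc p = ints s' ''r'' []" "?R div Suc p = ints s' ''q'' []"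
        by (simp_all del: mult_Suc)
      with 1 show ?case
        by (auto simp: algebra_simps)
    qed
    from wp_frame[OF this] show ?thesis
      by (rule wp_mono) auto
  qed
  have "wp p \<sigma> \<tau> (For ''l'' 1 e ?body) (set_int ''r'' [] ?N s)
      (\<lambda>t s'. t \<le> for_time n (11 + 14 * M) \<and> ?I (Suc n) s' \<and>
         frame (For ''l'' 1 e ?body) (set_int ''r'' [] ?N s) s')"
  proof (rule wp_For[where I = ?I])
    fix m s1
    assume m: "1 \<le> m" "ints s1 ''l'' [] = m" "frame (For ''l'' 1 e ?body) (set_int ''r'' [] ?N s) s1" "?I m s1"
    have "?N div Suc p ^ (m - 1) \<le> M"
      using M by (meson div_le_dividend le_trans)
    moreover have "ints s1 ''p'' [] = p"
      using frame_ints[OF m(3), of "''p''" "[]"] p d by auto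
    ultimately have loop': "wp p \<sigma> \<tau> ?loop (set_int ''q'' [] 0 s1)
      (\<lambda>t s'. t \<le> 4 + 14 * M \<and> ints s' ''r'' [] = ints (set_int ''q'' [] 0 s1) ''r'' [] mod Suc p \<and>
         ints s' ''q'' [] = ints (set_int ''q'' [] 0 s1) ''r'' [] div Suc p \<and> frame ?loop (set_int ''q'' [] 0 s1) s')"
      by (intro loop) (simp_all add: m(4) del: power_Suc)
    have "Suc p ^ m = Suc p ^ (m - 1) * Suc p"
      using m(1) by (cases m) (auto simp: mult.commute)
    then have quot: "?N div Suc p ^ (m - 1) div Suc p = ?N div Suc p ^ m"
      by (simp only: div_mult2_eq)
    have "wp p \<sigma> \<tau> (?loop ;; AssignI d [var ''l''] (var ''r'') ;; AssignI ''r'' [] (var ''q''))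
        (set_int ''q'' [] 0 s1)
        (\<lambda>t s2. 2 + t \<le> 11 + 14 * M \<and> ?I (Suc m) (set_int ''l'' [] (Suc m) s2))"
      unfolding wp_Seq
    proof (rule wp_mono[OF loop'], elim conjE)
      fix t s'
      assume t: "t \<le> 4 + 14 * M"
        and r: "ints s' ''r'' [] = ints (set_int ''q'' [] 0 s1) ''r'' [] mod Suc p"
        and q: "ints s' ''q'' [] = ints (set_int ''q'' [] 0 s1) ''r'' [] div Suc p"
        and f: "frame ?loop (set_int ''q'' [] 0 s1) s'"
      have l: "ints s' ''l'' [] = m" and d': "ints s' d js = ints s1 d js" for js
        using frame_ints[OF f, of "''l''"] frame_ints[OF f, of d] m(2) d by auto
      have "ints s' ''r'' [] = digit (Suc p) ?N m" "ints s' ''q'' [] = ?N div Suc p ^ m"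
        using m(4) quot by (simp_all add: r q digit_def del: power_Suc)
      then show "wp p \<sigma> \<tau> (AssignI d [var ''l''] (var ''r'')) s'
         (\<lambda>t1 s3. wp p \<sigma> \<tau> (AssignI ''r'' [] (var ''q'')) s3
            (\<lambda>t2 s4. 2 + (t + (t1 + t2)) \<le> 11 + 14 * M \<and> ?I (Suc m) (set_int ''l'' [] (Suc m) s4)))"
        using t l d' d m(4) by (auto simp: less_Suc_eq)
    qed
    then show "wp p \<sigma> \<tau> ?body s1
        (\<lambda>t s2. t \<le> 11 + 14 * M \<and> ?I (Suc m) (set_int ''l'' [] (Suc m) s2))"
      by (simp add: numeral_2_eq_2)
  next
    show "ival (set_int ''r'' [] ?N s) e = n"
      using e by (subst ival_cong[of e _ s]) (auto simp: set_int_def)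
  qed (use e d in auto)
  then show ?thesis
    unfolding digits_com_def digits_time_def wp_Seq wp_AssignI
    using d by simp (elim wp_mono, auto simp: frame_def set_int_def)
qed

definition fill_com :: "string \<Rightarrow> nat \<Rightarrow> com" where
  "fill_com a c = For ''m'' 1 (var ''p'') (AssignI a [var ''m''] (INum c))"

lemma arrays_fill_com [simp]:
  "iarrays (fill_com a c) = {a, ''m''}" "sarrays (fill_com a c) = {}"
  by (auto simp: fill_com_def)

lemma wp_fill_com:
  assumes "ints s ''p'' [] = p" "a \<notin> {''m'', ''p''}"
  shows "wp p \<sigma> \<tau> (fill_com a c) s
    (\<lambda>t s'. t \<le> for_time p 3 \<and> (\<forall>j\<in>nodes p. ints s' a [j] = c) \<and> frame (fill_com a c) s s')"
proof -
  have "wp p \<sigma> \<tau> (fill_com a c) s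
    (\<lambda>t s'. t \<le> for_time p 3 \<and> (\<forall>j\<in>{1..<Suc p}. ints s' a [j] = c) \<and> frame (fill_com a c) s s')"
    unfolding fill_com_def
    by (rule wp_For[where I = "\<lambda>m s'. \<forall>j\<in>{1..<m}. ints s' a [j] = c"])
      (use assms in \<open>auto simp: less_Suc_eq\<close>)
  then show ?thesis
    by (rule wp_mono) auto
qed

section \<open>The best parent set inside a set\<close>

text \<open>The digits of \<open>m\<close> in base \<open>p + 1\<close> name the elements; the digit \<open>0\<close> is not a node and stands for
  no element, so that all sets of at most \<open>k\<close> elements occur.\<close>

definition code_subset :: "nat \<Rightarrow> nat \<Rightarrow> nat set \<Rightarrow> nat \<Rightarrow> nat set" where
  "code_subset k p U m = U \<inter> digit (Suc p) m ` {1..k}"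

lemma card_code_subset: "card (code_subset k p U m) \<le> k"
proof -
  have "card (code_subset k p U m) \<le> card (digit (Suc p) m ` {1..k})"
    unfolding code_subset_def by (intro card_mono) auto
  also have "\<dots> \<le> k"
    using card_image_le[of "{1..k}" "digit (Suc p) m"] by simp
  finally show ?thesis .
qed

lemma exists_code_subset:
  assumes "Pa \<subseteq> U" "card Pa \<le> k" "U \<subseteq> nodes p"
  obtains m where "m \<le> Suc p ^ k" "code_subset k p U m = Pa"
proof -
  have "finite Pa"
    using assms finite_subset[of Pa "nodes p"] by auto
  then obtain h where h: "bij_betw h {1..card Pa} Pa"
    using ex_bij_betw_nat_finite_1 by blast
  \<comment> \<open>The enumeration of \<open>Pa\<close> is padded with the digit 0, which does not
    lie in \<open>U\<close>.\<close>
  define f where "f l = (if l \<le> card Pa then h l else 0)" for l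
  have "f l < Suc p" if "l \<in> {1..k}" for l
    using that bij_betwE[OF h] assms by (fastforce simp: f_def less_Suc_eq_le)
  then obtain m where m: "m < Suc p ^ k" "\<forall>l\<in>{1..k}. digit (Suc p) m l = f l"
    using exists_digits[of k f "Suc p"] unfolding digit_def by blast
  have "digit (Suc p) m ` {1..k} = f ` {1..k}"
    using m(2) by (intro image_cong) auto
  moreover have "U \<inter> f ` {1..k} = Pa"
  proof -
    have Pa: "h ` {1..card Pa} = Pa"
      using h by (simp add: bij_betw_def)
    have "f ` {1..k} \<subseteq> insert 0 Pa"
      using Pa by (auto simp: f_def)
    moreover have "Pa \<subseteq> f ` {1..k}"
    proof
      fix x
      assume "x \<in> Pa"
      then obtain l where "l \<in> {1..card Pa}" "x = h l"
        using Pa by blast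
      then have "x = f l" "l \<in> {1..k}"
        using assms(2) by (simp_all add: f_def)
      then show "x \<in> f ` {1..k}"
        by (rule image_eqI)
    qed
    moreover have "0 \<notin> U"
      using assms(3) by auto
    moreover have "U \<inter> S = Pa" if "S \<subseteq> insert 0 Pa" "Pa \<subseteq> S" "0 \<notin> U" for S
      using that assms(1) by blast
    ultimately show ?thesis
      by blast
  qed
  ultimately show ?thesis
    using that[of m] m(1) by (simp add: code_subset_def)
qed

definition column :: "nat \<Rightarrow> state \<Rightarrow> nat \<Rightarrow> nat set" where
  "column p s i = {j \<in> nodes p. ints s ''edge'' [j, i] \<noteq> 0}"

lemma parents_output_graph: "i \<in> nodes p \<Longrightarrow> parents (output_graph p s) i = column p s i"
  by (auto simp: parents_def output_graph_def column_def)

text \<open>The best parent set so far lives directly in column \<open>i\<close> of the output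
  matrix. The other columns are kept, so that a graph can be built up node by node.\<close>

definition record_com :: com where
  "record_com = AssignS ''best'' [] (SCell ''new'' []) ;;
     For ''m'' 1 (var ''p'')
       (AssignI ''edge'' [var ''m'', var ''i''] (ICell ''row'' [var ''m'']))"

lemma arrays_record_com [simp]:
  "iarrays record_com = {''m'', ''edge''}" "sarrays record_com = {''best''}"
  by (auto simp: record_com_def)

definition record_time :: "nat \<Rightarrow> nat" where
  "record_time p = 2 + for_time p 5"

lemma wp_record_com:
  assumes p: "ints s ''p'' [] = p"
  shows "wp p \<sigma> \<tau> record_com s
    (\<lambda>t s'. t \<le> record_time p \<and> scores s' ''best'' [] = scores s ''new'' [] \<and>
       column p s' (ints s ''i'' []) = row_set p s ''row'' [] \<and>
       (\<forall>i. i \<noteq> ints s ''i'' [] \<longrightarrow> column p s' i = column p s i) \<and> frame record_com s s')"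
proof -
  let ?i = "ints s ''i'' []" and ?s = "set_score ''best'' [] (scores s ''new'' []) s"
  let ?loop = "For ''m'' 1 (var ''p'')
       (AssignI ''edge'' [var ''m'', var ''i''] (ICell ''row'' [var ''m'']))"
  let ?I = "\<lambda>m s'. \<forall>j i. ints s' ''edge'' [j, i] =
    (if i = ?i \<and> j \<in> {1..<m} then ints s ''row'' [j] else ints s ''edge'' [j, i])"
  have "wp p \<sigma> \<tau> ?loop ?s (\<lambda>t s'. t \<le> for_time p 5 \<and> ?I (Suc p) s' \<and> frame ?loop ?s s')"
  proof (rule wp_For[where I = ?I])
    fix m s1
    assume m: "1 \<le> m" "ints s1 ''m'' [] = m" "frame ?loop ?s s1" "?I m s1"
    have "ints s1 ''i'' [] = ?i" "ints s1 ''row'' [m] = ints s ''row'' [m]"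
      using frame_ints[OF m(3), of "''i''"] frame_ints[OF m(3), of "''row''"] by auto
    with m show "wp p \<sigma> \<tau> (AssignI ''edge'' [var ''m'', var ''i''] (ICell ''row'' [var ''m''])) s1
        (\<lambda>t s2. t \<le> 5 \<and> ?I (Suc m) (set_int ''m'' [] (Suc m) s2))"
      by (auto simp: less_Suc_eq)
  qed (use p in auto)
  then show ?thesis
    unfolding record_com_def record_time_def wp_Seq wp_AssignS
    by simp (elim wp_mono, auto simp: frame_def column_def row_set_def)
qed

text \<open>A digit 0 may write \<open>row[0]\<close>. This is harmless, since a row is only read at
  indices in \<open>nodes p\<close>. Repeated digits merely set a cell twice.\<close>

definition select_com :: "nat \<Rightarrow> com" where
  "select_com k = digits_com ''n'' (INum k) ''digit'' ;;
     fill_com ''row'' 0 ;;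
     For ''l'' 1 (INum k)
       (Cond (ILess (INum 0) (ICell ''U'' [ICell ''digit'' [var ''l'']]))
         (AssignI ''row'' [ICell ''digit'' [var ''l'']] (INum 1)) Skip)"

lemma arrays_select_com [simp]:
  "iarrays (select_com k) = {''r'', ''l'', ''q'', ''digit'', ''row'', ''m''}"
  "sarrays (select_com k) = {}"
  by (auto simp: select_com_def)

definition select_time :: "nat \<Rightarrow> nat \<Rightarrow> nat \<Rightarrow> nat" where
  "select_time k p M = digits_time k M + for_time p 3 + for_time k 11"

lemma wp_select_com:
  assumes p: "ints s ''p'' [] = p" and M: "ints s ''n'' [] \<le> M"
  shows "wp p \<sigma> \<tau> (select_com k) s
    (\<lambda>t s'. t \<le> select_time k p M \<and>
       row_set p s' ''row'' [] = code_subset k p (row_set p s ''U'' []) (ints s ''n'' []) \<and>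
       frame (select_com k) s s')"
proof -
  let ?d = "digit (Suc p) (ints s ''n'' [])"
  let ?body = "Cond (ILess (INum 0) (ICell ''U'' [ICell ''digit'' [var ''l'']]))
         (AssignI ''row'' [ICell ''digit'' [var ''l'']] (INum 1)) Skip"
  let ?loop = "For ''l'' 1 (INum k) ?body"
  have loop: "wp p \<sigma> \<tau> ?loop s1
     (\<lambda>t s'. t \<le> for_time k 11 \<and>
       row_set p s' ''row'' [] = code_subset k p (row_set p s ''U'' []) (ints s ''n'' []))"
    if s1: "\<forall>l\<in>{1..k}. ints s1 ''digit'' [l] = ?d l" "\<forall>j\<in>nodes p. ints s1 ''row'' [j] = 0"
      "\<forall>j. ints s1 ''U'' [j] = ints s ''U'' [j]" for s1
  proof -
    let ?I = "\<lambda>m s'. \<forall>j\<in>nodes p. ints s' ''row'' [j] =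
      (if ints s ''U'' [j] \<noteq> 0 \<and> j \<in> ?d ` {1..<m} then 1 else 0)"
    have "wp p \<sigma> \<tau> ?loop s1 (\<lambda>t s'. t \<le> for_time k 11 \<and> ?I (Suc k) s' \<and> frame ?loop s1 s')"
    proof (rule wp_For[where I = ?I])
      fix m s2
      assume m: "1 \<le> m" "m \<le> k" "ints s2 ''l'' [] = m" "frame ?loop s1 s2" "?I m s2"
      have "ints s2 ''digit'' [m] = ?d m" "\<And>j. ints s2 ''U'' [j] = ints s ''U'' [j]"
        using frame_ints[OF m(4), of "''digit''"] frame_ints[OF m(4), of "''U''"] s1 m(1,2) by auto
      moreover have "?d ` {1..<Suc m} = insert (?d m) (?d ` {1..<m})"
        using m(1) by (auto simp: less_Suc_eq)
      ultimately show "wp p \<sigma> \<tau> ?body s2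
          (\<lambda>t s3. t \<le> 11 \<and> ?I (Suc m) (set_int ''l'' [] (Suc m) s3))"
        using m(3,5) by auto
    qed (use s1 in auto)
    then show ?thesis
    proof (rule wp_mono, elim conjE, intro conjI)
      fix t and s' :: state
      assume "?I (Suc k) s'"
      then have "{j \<in> nodes p. ints s' ''row'' [j] \<noteq> 0} =
          {j \<in> nodes p. ints s ''U'' [j] \<noteq> 0 \<and> j \<in> ?d ` {1..k}}"
        by (intro Collect_cong conj_cong refl) (simp add: atLeastLessThanSuc_atLeastAtMost)
      then show "row_set p s' ''row'' [] = code_subset k p (row_set p s ''U'' []) (ints s ''n'' [])"
        by (auto simp: row_set_def code_subset_def)
    qed
  qed
  have "wp p \<sigma> \<tau> (select_com k) s
    (\<lambda>t s'. t \<le> select_time k p M \<and>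
       row_set p s' ''row'' [] = code_subset k p (row_set p s ''U'' []) (ints s ''n'' []))"
    unfolding select_com_def wp_Seq
  proof (rule wp_mono[OF wp_digits_com[OF p _ _ _ _ M, of "INum k" k "''digit''"]], goal_cases)
    case (5 t1 s1)
    then have "ints s1 ''p'' [] = p" "\<And>j. ints s1 ''U'' [j] = ints s ''U'' [j]"
      using p by (auto simp: frame_def)
    note 5 = 5 this
    show ?case
    proof (rule wp_mono[OF wp_fill_com], goal_cases)
      case (3 t2 s2)
      have "\<forall>l\<in>{1..k}. ints s2 ''digit'' [l] = ?d l" "\<forall>j. ints s2 ''U'' [j] = ints s ''U'' [j]"
        using 5 3 by (auto simp: frame_def)
      with 3 have "wp p \<sigma> \<tau> ?loop s2
         (\<lambda>t s'. t \<le> for_time k 11 \<and>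
           row_set p s' ''row'' [] = code_subset k p (row_set p s ''U'' []) (ints s ''n'' []))"
        by (intro loop) auto
      then show ?case
        using 5 3 by (elim wp_mono) (auto simp: select_time_def)
    qed (use 5 in auto)
  qed auto
  from wp_frame[OF this] show ?thesis
    by (rule wp_mono) auto
qed

text \<open>Evaluating the empty set before the loop replaces whatever \<open>best\<close> and
  column \<open>i\<close> held by a legitimate first choice, whatever \<open>k\<close> is.\<close>

definition best_com :: "nat \<Rightarrow> com" where
  "best_com k = fill_com ''row'' 0 ;;
     Query ''new'' [] (var ''i'') ''row'' [] ;;
     record_com ;;
     power_com (INum k) ''w'' ;;
     For ''n'' 0 (var ''w'')
       (select_com k ;;
        Query ''new'' [] (var ''i'') ''row'' [] ;;
        Cond (SLess (SCell ''best'' []) (SCell ''new'' [])) record_com Skip)"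

definition best_arrays :: "string set" where
  "best_arrays = {''row'', ''m'', ''edge'', ''w'', ''l'', ''t'', ''j'', ''n'', ''r'', ''q'', ''digit''}"

lemma arrays_best_com [simp]:
  "iarrays (best_com k) = best_arrays" "sarrays (best_com k) = {''new'', ''best''}"
  by (auto simp: best_com_def best_arrays_def)

definition best_time :: "nat \<Rightarrow> nat \<Rightarrow> nat \<Rightarrow> nat" where
  "best_time k p B = for_time p 3 + (2 + B) + record_time p + power_time p k +
     for_time (Suc p ^ k) (select_time k p (Suc p ^ k) + (2 + B) + (5 + record_time p))"

text \<open>Only allowed parent sets are bounded, so a program with a time guarantee may query no
  others: every row that is queried is cut down to a set without \<open>i\<close> and to at most
  \<open>k\<close> elements.\<close>

definition queries_within :: "nat \<Rightarrow> nat \<Rightarrow> nat \<Rightarrow> (nat \<Rightarrow> nat set \<Rightarrow> nat) \<Rightarrow> bool" where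
  "queries_within k p B \<tau> \<longleftrightarrow>
     (\<forall>i\<in>nodes p. \<forall>Pa. Pa \<subseteq> nodes p - {i} \<longrightarrow> card Pa \<le> k \<longrightarrow> \<tau> i Pa \<le> B)"

lemma wp_best_com:
  assumes p: "ints s ''p'' [] = p" and i: "ints s ''i'' [] = i" "i \<in> nodes p"
    and U: "row_set p s ''U'' [] = U" "i \<notin> U" and B: "queries_within k p B \<tau>"
  shows "wp p \<sigma> \<tau> (best_com k) s
    (\<lambda>t s'. t \<le> best_time k p B \<and> scores s' ''best'' [] = best_score k \<sigma> i U \<and>
       column p s' i \<subseteq> U \<and> card (column p s' i) \<le> k \<and>
       \<sigma> i (column p s' i) = best_score k \<sigma> i U \<and>
       (\<forall>i'. i' \<noteq> i \<longrightarrow> column p s' i' = column p s i') \<and> frame (best_com k) s s')"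
proof -
  let ?w = "Suc p ^ k"
  let ?body = "select_com k ;; Query ''new'' [] (var ''i'') ''row'' [] ;;
        Cond (SLess (SCell ''best'' []) (SCell ''new'' [])) record_com Skip"
  let ?T = "select_time k p ?w + (2 + B) + (5 + record_time p)"
  let ?I = "\<lambda>m s'. scores s' ''best'' [] = \<sigma> i (column p s' i) \<and> column p s' i \<subseteq> U \<and>
     card (column p s' i) \<le> k \<and> (\<forall>n<m. \<sigma> i (code_subset k p U n) \<le> \<sigma> i (column p s' i)) \<and>
     (\<forall>i'. i' \<noteq> i \<longrightarrow> column p s' i' = column p s i')"
  let ?loop = "For ''n'' 0 (var ''w'') ?body"
  have Un: "U \<subseteq> nodes p"
    using U by (auto simp: row_set_def)
  have time: "\<tau> i Pa \<le> B" if "Pa \<subseteq> U" "card Pa \<le> k" for Pa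
  proof -
    have "Pa \<subseteq> nodes p - {i}"
      using that(1) Un U(2) by blast
    with that(2) B i(2) show ?thesis
      by (simp add: queries_within_def)
  qed
  have cols: "column p (set_int ''n'' [] m s1) i' = column p s1 i'"
    "column p (set_score x xs r s1) i' = column p s1 i'" for m s1 i' x xs r
    by (auto simp: column_def)
  have row: "row_set p (set_score x xs r s1) a as = row_set p s1 a as" for s1 x xs r a as
    by (auto simp: row_set_def)
  have loop: "wp p \<sigma> \<tau> ?loop s1 (\<lambda>t s'. t \<le> for_time ?w ?T \<and> ?I (Suc ?w) s' \<and> frame ?loop s1 s')"
    if s1: "ints s1 ''w'' [] = ?w" "ints s1 ''p'' [] = p" "ints s1 ''i'' [] = i"
      "row_set p s1 ''U'' [] = U" "?I 0 s1" for s1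
  proof (rule wp_For[where I = ?I])
    fix m s2
    assume m: "m \<le> ?w" "ints s2 ''n'' [] = m" "frame ?loop s1 s2" and I: "?I m s2"
    have s2: "ints s2 ''p'' [] = p" "ints s2 ''i'' [] = i" "row_set p s2 ''U'' [] = U"
      using frame_ints[OF m(3), of "''p''"] frame_ints[OF m(3), of "''i''"]
        frame_ints[OF m(3), of "''U''"] s1 by (auto simp: row_set_def)
    show "wp p \<sigma> \<tau> ?body s2 (\<lambda>t s3. t \<le> ?T \<and> ?I (Suc m) (set_int ''n'' [] (Suc m) s3))"
      unfolding wp_Seq
    proof (rule wp_mono[OF wp_select_com[OF s2(1), of ?w]], goal_cases)
      case 1
      then show ?case using m by simp
    next
      case (2 t s3)
      let ?P = "code_subset k p U m"
      have row3: "row_set p s3 ''row'' [] = ?P"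
        using 2 s2(3) m(2) by simp
      have fr: "frame (select_com k) s2 s3"
        using 2 by simp
      have s3: "ints s3 ''i'' [] = i" "ints s3 ''p'' [] = p" "scores s3 x xs = scores s2 x xs"
        "column p s3 i' = column p s2 i'" for i' x xs
        using s2 by (simp_all add: frame_ints[OF fr] frame_scores[OF fr] column_def)
      have \<tau>P: "\<tau> i ?P \<le> B"
        using card_code_subset by (intro time) (auto simp: code_subset_def)
      let ?s4 = "set_score ''new'' [] (\<sigma> i ?P) s3"
      show ?case
      proof (cases "scores s2 ''best'' [] < \<sigma> i ?P")
        case False
        then show ?thesis
          using 2 row3 s3 \<tau>P I by (simp add: Let_def row cols less_Suc_eq all_conj_distrib)
      next
        case True
        have "wp p \<sigma> \<tau> record_com ?s4 (\<lambda>t' s5. t + (2 + \<tau> i ?P + (4 + t')) \<le> ?T \<and>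
            ?I (Suc m) (set_int ''n'' [] (Suc m) s5))"
        proof (rule wp_mono[OF wp_record_com], goal_cases)
          case 1
          then show ?case using s3 by simp
        next
          case (2 t' s5)
          then have best: "scores s5 ''best'' [] = \<sigma> i ?P" and col: "column p s5 i = ?P"
            and other: "\<forall>i'. i' \<noteq> i \<longrightarrow> column p s5 i' = column p s2 i'" and "t' \<le> record_time p"
            using s3 row3 by (auto simp: row cols)
          moreover have "\<forall>n<Suc m. \<sigma> i (code_subset k p U n) \<le> \<sigma> i ?P"
            using I True by (force simp: less_Suc_eq)
          moreover have "?P \<subseteq> U"
            by (simp add: code_subset_def)
          ultimately show ?case
            using \<open>t \<le> _ \<and> _\<close> \<tau>P I card_code_subset[of k p U m] by (simp add: cols)
        qed
        then show ?thesis
          using True row3 s3 by (simp add: Let_def row cols)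
      qed
    qed
  qed (use s1 in \<open>auto simp: cols best_arrays_def\<close>)
  have "wp p \<sigma> \<tau> (best_com k) s (\<lambda>t s'. t \<le> best_time k p B \<and> ?I (Suc ?w) s')"
    unfolding best_com_def wp_Seq
  proof (rule wp_mono[OF wp_fill_com[OF p]], goal_cases)
    case (2 t1 s1)
    then have s1: "ints s1 ''p'' [] = p" "ints s1 ''i'' [] = i" "row_set p s1 ''U'' [] = U"
      "row_set p s1 ''row'' [] = {}" "column p s1 i' = column p s i'" for i'
      using p i U by (auto simp: frame_def row_set_def column_def)
    have \<tau>: "\<tau> i {} \<le> B"
      by (rule time) auto
    let ?s2 = "set_score ''new'' [] (\<sigma> i {}) s1"
    have "wp p \<sigma> \<tau> record_com ?s2 (\<lambda>t3 s3. wp p \<sigma> \<tau> (power_com (INum k) ''w'') s3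
       (\<lambda>t4 s4. wp p \<sigma> \<tau> ?loop s4
          (\<lambda>t5 s'. t1 + (2 + \<tau> i {} + (t3 + (t4 + t5))) \<le> best_time k p B \<and> ?I (Suc ?w) s')))"
    proof (rule wp_mono[OF wp_record_com], goal_cases)
      case 1
      show ?case using s1 by simp
    next
      case (2 t3 s3)
      then have fr: "frame record_com (set_score ''new'' [] (\<sigma> i {}) s1) s3"
        by simp
      have "row_set p s3 ''U'' [] = U"
        using s1(3) by (simp add: row_set_def frame_ints[OF fr])
      with 2 have s3: "ints s3 ''p'' [] = p" "ints s3 ''i'' [] = i" "row_set p s3 ''U'' [] = U"
        "scores s3 ''best'' [] = \<sigma> i {}" "column p s3 i = {}" "t3 \<le> record_time p"
        "\<forall>i'. i' \<noteq> i \<longrightarrow> column p s3 i' = column p s i'"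
        using s1 by (simp_all add: frame_ints[OF fr] row cols)
      show ?case
      proof (rule wp_mono[OF wp_power_com[OF s3(1), of "INum k" k]], goal_cases)
        case (5 t4 s4)
        then have s4: "ints s4 ''p'' [] = p" "ints s4 ''i'' [] = i" "row_set p s4 ''U'' [] = U"
          "scores s4 ''best'' [] = \<sigma> i {}" "column p s4 i' = column p s3 i'" for i'
          using s3 by (auto simp: frame_def row_set_def column_def)
        have "wp p \<sigma> \<tau> ?loop s4 (\<lambda>t s'. t \<le> for_time ?w ?T \<and> ?I (Suc ?w) s' \<and> frame ?loop s4 s')"
          using 5 s3 s4 by (intro loop) auto
        then show ?case
          using 5 s3 \<open>t1 \<le> _ \<and> _\<close> \<tau> by (elim wp_mono) (simp add: best_time_def)
      qed auto
    qed
    then show ?case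
      using s1 by (simp add: Let_def)
  qed auto
  from wp_frame[OF this] show ?thesis
  proof (rule wp_mono, elim conjE, goal_cases)
    case (1 t s')
    \<comment> \<open>Each allowed set has a code in the range of the loop, hence was compared with
      the stored one.\<close>
    have "\<sigma> i Q \<le> \<sigma> i (column p s' i)" if Q: "Q \<subseteq> U" "card Q \<le> k" for Q
    proof -
      obtain m where "m \<le> ?w" "code_subset k p U m = Q"
        using exists_code_subset[OF Q Un] .
      with 1 show ?thesis
        by (auto simp: less_Suc_eq_le)
    qed
    then have "best_score k \<sigma> i U = \<sigma> i (column p s' i)"
      using 1 Un by (intro best_score_eqI) (auto intro: finite_subset)
    with 1 show ?case
      by simp
  qed
qed

section \<open>Computing the score tables\<close>

text \<open>The four choices of \<open>c\<close> and \<open>b\<close> produce the four kinds of sets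
  in the score tables. Clearing \<open>i\<close> last keeps it out of \<open>U\<close> even when
  \<open>h = i\<close>.\<close>

definition entry_com :: "nat \<Rightarrow> nat \<Rightarrow> nat \<Rightarrow> string \<Rightarrow> string list \<Rightarrow> com" where
  "entry_com k c b x ys = fill_com ''U'' c ;;
     AssignI ''U'' [var ''h''] (INum b) ;;
     AssignI ''U'' [var ''i''] (INum 0) ;;
     best_com k ;;
     AssignS x (map var ys) (SCell ''best'' [])"

lemma arrays_entry_com [simp]:
  "iarrays (entry_com k c b x ys) = insert ''U'' best_arrays"
  "sarrays (entry_com k c b x ys) = {''new'', ''best'', x}"
  by (auto simp: entry_com_def best_arrays_def)

text \<open>The 10 is 3 for each of the two assignments to \<open>U\<close> and at most 4 for
  storing the result under one or two indices.\<close>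

definition entry_time :: "nat \<Rightarrow> nat \<Rightarrow> nat \<Rightarrow> nat" where
  "entry_time k p B = for_time p 3 + best_time k p B + 10"

lemma wp_entry_com:
  assumes p: "ints s ''p'' [] = p" and i: "ints s ''i'' [] = i" "i \<in> nodes p"
    and h: "ints s ''h'' [] = h" and U: "U = {j \<in> nodes p. j \<noteq> i \<and> (if j = h then b else c) \<noteq> 0}"
    and ys: "set ys \<subseteq> {''i'', ''h''}" "length ys \<le> 2" and B: "queries_within k p B \<tau>"
  shows "wp p \<sigma> \<tau> (entry_com k c b x ys) s
    (\<lambda>t s'. t \<le> entry_time k p B \<and>
       scores s' x (map (\<lambda>y. ints s y []) ys) = best_score k \<sigma> i U \<and>
       (\<forall>y zs. y \<notin> {''new'', ''best''} \<longrightarrow> (y, zs) \<noteq> (x, map (\<lambda>y. ints s y []) ys) \<longrightarrow>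
          scores s' y zs = scores s y zs) \<and>
       frame (entry_com k c b x ys) s s')"
proof -
  have "wp p \<sigma> \<tau> (entry_com k c b x ys) s
    (\<lambda>t s'. t \<le> entry_time k p B \<and>
       scores s' x (map (\<lambda>y. ints s y []) ys) = best_score k \<sigma> i U \<and>
       (\<forall>y zs. y \<notin> {''new'', ''best''} \<longrightarrow> (y, zs) \<noteq> (x, map (\<lambda>y. ints s y []) ys) \<longrightarrow>
          scores s' y zs = scores s y zs))"
    unfolding entry_com_def wp_Seq
  proof (rule wp_mono[OF wp_fill_com[OF p]], goal_cases)
    case (2 t1 s1)
    then have f1: "frame (fill_com ''U'' c) s s1"
      by simp
    let ?s2 = "set_int ''U'' [i] 0 (set_int ''U'' [h] b s1)"
    have s2: "ints ?s2 ''p'' [] = p" "ints ?s2 ''i'' [] = i" "ints s1 ''h'' [] = h" "ints s1 ''i'' [] = i"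
      using p i h by (simp_all add: frame_ints[OF f1])
    have "row_set p ?s2 ''U'' [] = U"
      using 2 U by (auto simp: row_set_def)
    then have "wp p \<sigma> \<tau> (best_com k) ?s2
      (\<lambda>t s'. t \<le> best_time k p B \<and> scores s' ''best'' [] = best_score k \<sigma> i U \<and> frame (best_com k) ?s2 s')"
      using U by (intro wp_mono[OF wp_best_com[OF s2(1,2) i(2) _ _ B]]) auto
    then have "wp p \<sigma> \<tau> (best_com k) ?s2 (\<lambda>t s'. wp p \<sigma> \<tau> (AssignS x (map var ys) (SCell ''best'' [])) s'
      (\<lambda>t' s'. t1 + (3 + (3 + (t + t'))) \<le> entry_time k p B \<and>
       scores s' x (map (\<lambda>y. ints s y []) ys) = best_score k \<sigma> i U \<and>
       (\<forall>y zs. y \<notin> {''new'', ''best''} \<longrightarrow> (y, zs) \<noteq> (x, map (\<lambda>y. ints s y []) ys) \<longrightarrow>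
          scores s' y zs = scores s y zs)))"
    proof (rule wp_mono, elim conjE)
      fix t3 s3
      assume t3: "t3 \<le> best_time k p B" and best: "scores s3 ''best'' [] = best_score k \<sigma> i U"
        and f3: "frame (best_com k) ?s2 s3"
      have "ints s3 y [] = ints s y []" if "y \<in> {''i'', ''h''}" for y
        using that i h s2 frame_ints[OF f3, of y "[]"] by (auto simp: best_arrays_def)
      then have "map (ival s3 \<circ> var) ys = map (\<lambda>y. ints s y []) ys"
        using ys(1) by (intro map_cong) auto
      moreover have "scores s3 y zs = scores s y zs" if "y \<notin> {''new'', ''best''}" for y zs
        using that frame_scores[OF f3, of y zs] frame_scores[OF f1, of y zs] by auto
      moreover have "sum_list (map (icost \<circ> var) ys) = length ys"
        by (induction ys) auto
      ultimately show "wp p \<sigma> \<tau> (AssignS x (map var ys) (SCell ''best'' [])) s3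
        (\<lambda>t' s'. t1 + (3 + (3 + (t3 + t'))) \<le> entry_time k p B \<and>
         scores s' x (map (\<lambda>y. ints s y []) ys) = best_score k \<sigma> i U \<and>
         (\<forall>y zs. y \<notin> {''new'', ''best''} \<longrightarrow> (y, zs) \<noteq> (x, map (\<lambda>y. ints s y []) ys) \<longrightarrow>
            scores s' y zs = scores s y zs))"
        using t3 best 2 ys(2) by (simp add: entry_time_def)
    qed
    then show ?case
      using s2 by (simp add: eval_nat_numeral del: wp_AssignS)
  qed auto
  from wp_frame[OF this] show ?thesis
    by (rule wp_mono) simp
qed

text \<open>The entries of \<open>empty\<close> and \<open>others\<close> do not depend on
  \<open>h\<close> and are recomputed for each \<open>h\<close>. This keeps one loop body for all
  four tables at the price of a constant factor.\<close>

definition tables_com :: "nat \<Rightarrow> com" where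
  "tables_com k = For ''i'' 1 (var ''p'') (For ''h'' 1 (var ''p'')
     (entry_com k 0 0 ''empty'' [''i''] ;;
      entry_com k 1 1 ''others'' [''i''] ;;
      entry_com k 0 1 ''single'' [''i'', ''h''] ;;
      entry_com k 1 0 ''without'' [''i'', ''h'']))"

definition tables_time :: "nat \<Rightarrow> nat \<Rightarrow> nat \<Rightarrow> nat" where
  "tables_time k p B = for_time p (for_time p (4 * entry_time k p B))"

definition entries_ok :: "nat \<Rightarrow> nat \<Rightarrow> local_score \<Rightarrow> state \<Rightarrow> nat \<Rightarrow> nat \<Rightarrow> bool" where
  "entries_ok k p \<sigma> s i h \<longleftrightarrow>
     scores s ''empty'' [i] = best_score k \<sigma> i {} \<and>
     scores s ''others'' [i] = best_score k \<sigma> i (nodes p - {i}) \<and>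
     (h \<noteq> i \<longrightarrow> scores s ''single'' [i, h] = best_score k \<sigma> i {h} \<and>
        scores s ''without'' [i, h] = best_score k \<sigma> i (nodes p - {i, h}))"

text \<open>Finished entries survive because a cell is either untouched or overwritten by the very
  value that \<open>entries_ok\<close> asks for.\<close>

lemma wp_entries:
  assumes p: "ints s ''p'' [] = p" and i: "ints s ''i'' [] = i" "i \<in> nodes p"
    and h: "ints s ''h'' [] = h" "h \<in> nodes p" and B: "queries_within k p B \<tau>"
  shows "wp p \<sigma> \<tau>
     (entry_com k 0 0 ''empty'' [''i''] ;;
      entry_com k 1 1 ''others'' [''i''] ;;
      entry_com k 0 1 ''single'' [''i'', ''h''] ;;
      entry_com k 1 0 ''without'' [''i'', ''h'']) s
    (\<lambda>t s'. t \<le> 4 * entry_time k p B \<and> entries_ok k p \<sigma> s' i h \<and>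
       (\<forall>i' h'. entries_ok k p \<sigma> s i' h' \<longrightarrow> entries_ok k p \<sigma> s' i' h'))"
  unfolding wp_Seq
proof (rule wp_mono[OF wp_entry_com[OF p i h(1) refl _ _ B]], goal_cases)
  case (3 t1 s1)
  then have f: "frame (entry_com k 0 0 ''empty'' [''i'']) s s1"
    by simp
  have s1: "ints s1 ''p'' [] = p" "ints s1 ''i'' [] = i" "ints s1 ''h'' [] = h"
    using p i h by (simp_all add: frame_ints[OF f] best_arrays_def)
  show ?case
  proof (rule wp_mono[OF wp_entry_com[OF s1(1,2) i(2) s1(3) refl _ _ B]], goal_cases)
    case (3 t2 s2)
    then have f: "frame (entry_com k 1 1 ''others'' [''i'']) s1 s2"
      by simp
    have s2: "ints s2 ''p'' [] = p" "ints s2 ''i'' [] = i" "ints s2 ''h'' [] = h"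
      using s1 by (simp_all add: frame_ints[OF f] best_arrays_def)
    show ?case
    proof (rule wp_mono[OF wp_entry_com[OF s2(1,2) i(2) s2(3) refl _ _ B]], goal_cases)
      case (3 t3 s3)
      then have f: "frame (entry_com k 0 1 ''single'' [''i'', ''h'']) s2 s3"
        by simp
      have s3: "ints s3 ''p'' [] = p" "ints s3 ''i'' [] = i" "ints s3 ''h'' [] = h"
        using s2 by (simp_all add: frame_ints[OF f] best_arrays_def)
      show ?case
      proof (rule wp_mono[OF wp_entry_com[OF s3(1,2) i(2) s3(3) refl _ _ B]], goal_cases)
        case (3 t4 s4)
        have sets: "{j \<in> nodes p. j \<noteq> i \<and> (if j = h then 0 else 0) \<noteq> (0::nat)} = {}"
          "{j \<in> nodes p. j \<noteq> i \<and> (if j = h then 1 else 1) \<noteq> (0::nat)} = nodes p - {i}"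
          "{j \<in> nodes p. j \<noteq> i \<and> (if j = h then 1 else 0) \<noteq> (0::nat)} = {h} - {i}"
          "{j \<in> nodes p. j \<noteq> i \<and> (if j = h then 0 else 1) \<noteq> (0::nat)} = nodes p - {i, h}"
          using h(2) by auto
        note E1 = \<open>t1 \<le> _ \<and> _\<close>[unfolded sets list.map i h]
        note E2 = \<open>t2 \<le> _ \<and> _\<close>[unfolded sets list.map s1]
        note E3 = \<open>t3 \<le> _ \<and> _\<close>[unfolded sets list.map s2]
        note E4 = 3[unfolded sets list.map s3]
        let ?b = "best_score k \<sigma> i"
        note new = E1[THEN conjunct2, THEN conjunct1] E2[THEN conjunct2, THEN conjunct1]
          E3[THEN conjunct2, THEN conjunct1] E4[THEN conjunct2, THEN conjunct1]
        note old = E1[THEN conjunct2, THEN conjunct2, THEN conjunct1, rule_format]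
          E2[THEN conjunct2, THEN conjunct2, THEN conjunct1, rule_format]
          E3[THEN conjunct2, THEN conjunct2, THEN conjunct1, rule_format]
          E4[THEN conjunct2, THEN conjunct2, THEN conjunct1, rule_format]
        \<comment> \<open>\<open>{h} - {i}\<close> is \<open>{h}\<close> unless
          \<open>h = i\<close>, and the tables promise nothing about diagonal cells.\<close>
        have sc: "scores s4 x xs =
          (if x = ''empty'' \<and> xs = [i] then ?b {} else
           if x = ''others'' \<and> xs = [i] then ?b (nodes p - {i}) else
           if x = ''single'' \<and> xs = [i, h] then ?b ({h} - {i}) else
           if x = ''without'' \<and> xs = [i, h] then ?b (nodes p - {i, h}) else scores s x xs)"
          if "x \<in> {''empty'', ''others'', ''single'', ''without''}" for x xs
          using that by (elim insertE) (simp_all add: new old)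
        have "t1 + (t2 + (t3 + t4)) \<le> 4 * entry_time k p B"
          using E1 E2 E3 E4 by linarith
        moreover have "entries_ok k p \<sigma> s4 i h"
          by (simp add: entries_ok_def sc)
        moreover have "entries_ok k p \<sigma> s4 i' h'" if "entries_ok k p \<sigma> s i' h'" for i' h'
          using that by (auto simp: entries_ok_def sc)
        ultimately show ?case
          by blast
      qed auto
    qed auto
  qed auto
qed auto

lemma wp_tables_com:
  assumes p: "ints s ''p'' [] = p" and B: "queries_within k p B \<tau>"
  shows "wp p \<sigma> \<tau> (tables_com k) s
    (\<lambda>t s'. t \<le> tables_time k p B \<and> holds_score_tables k p \<sigma> s')"
proof -
  let ?body = "entry_com k 0 0 ''empty'' [''i''] ;;
      entry_com k 1 1 ''others'' [''i''] ;;
      entry_com k 0 1 ''single'' [''i'', ''h''] ;;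
      entry_com k 1 0 ''without'' [''i'', ''h'']"
  let ?inner = "For ''h'' 1 (var ''p'') ?body"
  let ?J = "\<lambda>m s'. \<forall>i\<in>{1..<m}. \<forall>h\<in>nodes p. entries_ok k p \<sigma> s' i h"
  have ok: "entries_ok k p \<sigma> (set_int x xs n s1) i h = entries_ok k p \<sigma> s1 i h" for x xs n s1 i h
    by (simp add: entries_ok_def)
  have inner: "wp p \<sigma> \<tau> ?inner s1 (\<lambda>t s'. t \<le> for_time p (4 * entry_time k p B) \<and>
      ?J (Suc m) s')"
    if s1: "ints s1 ''p'' [] = p" "ints s1 ''i'' [] = m" "m \<in> nodes p" "?J m s1" for s1 m
  proof -
    let ?I = "\<lambda>n s'. ?J m s' \<and> (\<forall>h\<in>{1..<n}. entries_ok k p \<sigma> s' m h)"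
    have "wp p \<sigma> \<tau> ?inner s1 (\<lambda>t s'. t \<le> for_time p (4 * entry_time k p B) \<and> ?I (Suc p) s' \<and> frame ?inner s1 s')"
    proof (rule wp_For[where I = ?I])
      fix n s2
      assume n: "1 \<le> n" "n \<le> p" "ints s2 ''h'' [] = n" and f: "frame ?inner s1 s2" and I: "?I n s2"
      have "ints s2 ''p'' [] = p" "ints s2 ''i'' [] = m"
        using s1 by (simp_all add: frame_ints[OF f] best_arrays_def)
      then have "wp p \<sigma> \<tau> ?body s2 (\<lambda>t s'. t \<le> 4 * entry_time k p B \<and> entries_ok k p \<sigma> s' m n \<and>
          (\<forall>i' h'. entries_ok k p \<sigma> s2 i' h' \<longrightarrow> entries_ok k p \<sigma> s' i' h'))"
        using n s1(3) by (intro wp_entries B) auto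
      then show "wp p \<sigma> \<tau> ?body s2
          (\<lambda>t s3. t \<le> 4 * entry_time k p B \<and> ?I (Suc n) (set_int ''h'' [] (Suc n) s3))"
        using I by (elim wp_mono) (auto simp: ok less_Suc_eq)
    qed (use s1 in \<open>auto simp: ok best_arrays_def\<close>)
    then show ?thesis
      by (rule wp_mono) (auto simp: atLeastLessThanSuc_atLeastAtMost le_less)
  qed
  have "wp p \<sigma> \<tau> (tables_com k) s
    (\<lambda>t s'. t \<le> tables_time k p B \<and> ?J (Suc p) s' \<and> frame (tables_com k) s s')"
    unfolding tables_com_def tables_time_def
  proof (rule wp_For[where I = ?J])
    fix m s1
    assume m: "1 \<le> m" "m \<le> p" "ints s1 ''i'' [] = m" and f: "frame (For ''i'' 1 (var ''p'') ?inner) s s1"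
      and J: "?J m s1"
    have "ints s1 ''p'' [] = p"
      using p by (simp add: frame_ints[OF f] best_arrays_def)
    then have "wp p \<sigma> \<tau> ?inner s1 (\<lambda>t s'. t \<le> for_time p (4 * entry_time k p B) \<and> ?J (Suc m) s')"
      using m J by (intro inner) auto
    then show "wp p \<sigma> \<tau> ?inner s1 (\<lambda>t s2. t \<le> for_time p (4 * entry_time k p B) \<and>
        ?J (Suc m) (set_int ''i'' [] (Suc m) s2))"
      by (simp add: ok)
  qed (use p in \<open>auto simp: best_arrays_def\<close>)
  then show ?thesis
  proof (rule wp_mono, elim conjE, intro conjI)
    fix t and s' :: state
    assume J: "?J (Suc p) s'" and f: "frame (tables_com k) s s'"
    have "ints s' ''p'' [] = p"
      using p by (simp add: frame_ints[OF f] tables_com_def best_arrays_def)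
    moreover have "entries_ok k p \<sigma> s' i h" if "i \<in> nodes p" "h \<in> nodes p" for i h
      using J that by auto
    ultimately show "holds_score_tables k p \<sigma> s'"
      unfolding holds_score_tables_def entries_ok_def by blast
  qed
qed

section \<open>Checking the candidate matching\<close>

text \<open>\<open>edge\<close> is cleared first, since its initial contents are arbitrary. The
  nested negations express \<open>i \<noteq> h\<close>, as the machine only has \<open><\<close>.
  \<open>hit\<close> records that \<open>i\<close> has a partner with positive gain,
  \<open>ok\<close> that no test has failed so far.\<close>

definition pair_com :: com where
  "pair_com = AssignI ''edge'' [var ''h'', var ''i''] (INum 0) ;;
     Cond (BAnd (BNot (BAnd (BNot (ILess (var ''i'') (var ''h''))) (BNot (ILess (var ''h'') (var ''i'')))))
            (SLess (SCell ''empty'' [var ''i'']) (SCell ''single'' [var ''i'', var ''h''])))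
       (AssignI ''hit'' [] (INum 1) ;;
        Cond (ILess (var ''h'') (var ''i'')) (AssignI ''edge'' [var ''h'', var ''i''] (INum 1)) Skip ;;
        Cond (BAnd (BNot (SLess (SCell ''empty'' [var ''i'']) (SCell ''without'' [var ''i'', var ''h''])))
               (BNot (SLess (SCell ''single'' [var ''i'', var ''h'']) (SCell ''others'' [var ''i'']))))
          Skip (AssignI ''ok'' [] (INum 0)))
       Skip"

definition check_com :: com where
  "check_com = AssignI ''ok'' [] (INum 1) ;;
     For ''i'' 1 (var ''p'')
       (AssignI ''hit'' [] (INum 0) ;;
        For ''h'' 1 (var ''p'') pair_com ;;
        Cond (BAnd (ILess (var ''hit'') (INum 1)) (SLess (SCell ''empty'' [var ''i'']) (SCell ''others'' [var ''i''])))
          (AssignI ''ok'' [] (INum 0)) Skip)"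

lemma arrays_check_com [simp]:
  "iarrays pair_com = {''edge'', ''hit'', ''ok''}" "sarrays pair_com = {}"
  "iarrays check_com = {''edge'', ''hit'', ''ok'', ''i'', ''h''}" "sarrays check_com = {}"
  by (auto simp: check_com_def pair_com_def)

text \<open>100 and 20 are generous roundings of the cost of \<open>pair_com\<close> and of the
  remaining work for one node; it only matters that they do not depend on \<open>p\<close>.\<close>

definition check_time :: "nat \<Rightarrow> nat" where
  "check_time p = 2 + for_time p (for_time p 100 + 20)"

definition gains :: "nat \<Rightarrow> local_score \<Rightarrow> nat \<Rightarrow> nat \<Rightarrow> bool" where
  "gains k \<sigma> i h \<longleftrightarrow> h \<noteq> i \<and> best_score k \<sigma> i {} < best_score k \<sigma> i {h}"

definition saturated :: "nat \<Rightarrow> nat \<Rightarrow> local_score \<Rightarrow> nat \<Rightarrow> nat \<Rightarrow> bool" where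
  "saturated k p \<sigma> i h \<longleftrightarrow>
     best_score k \<sigma> i (nodes p - {i, h}) \<le> best_score k \<sigma> i {} \<and>
     best_score k \<sigma> i (nodes p - {i}) \<le> best_score k \<sigma> i {h}"

text \<open>This is the form that the inner loop computes: a conjunction over \<open>h\<close>,
  accumulated in \<open>ok\<close>, and an existence statement, accumulated in \<open>hit\<close>
  and consulted after the loop.\<close>

lemma matching_conditions_alt:
  "matching_conditions k p \<sigma> i \<longleftrightarrow>
     (\<forall>h\<in>nodes p. gains k \<sigma> i h \<longrightarrow> saturated k p \<sigma> i h) \<and>
     ((\<exists>h\<in>nodes p. gains k \<sigma> i h) \<or> best_score k \<sigma> i (nodes p - {i}) \<le> best_score k \<sigma> i {})"
proof -
  have "(\<forall>h\<in>nodes p - {i}. best_score k \<sigma> i {h} \<le> best_score k \<sigma> i {}) \<longleftrightarrow> \<not> (\<exists>h\<in>nodes p. gains k \<sigma> i h)"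
    by (auto simp: gains_def not_less)
  then show ?thesis
    unfolding matching_conditions_def saturated_def by (auto simp: gains_def)
qed

lemma wp_pair_com:
  assumes T: "holds_score_tables k p \<sigma> s" and i: "ints s ''i'' [] = i" "i \<in> nodes p"
    and h: "ints s ''h'' [] = h" "h \<in> nodes p"
  shows "wp p \<sigma> \<tau> pair_com s
    (\<lambda>t s'. t \<le> 100 \<and>
       (ints s' ''ok'' [] \<noteq> 0 \<longleftrightarrow> ints s ''ok'' [] \<noteq> 0 \<and> (gains k \<sigma> i h \<longrightarrow> saturated k p \<sigma> i h)) \<and>
       (ints s' ''hit'' [] \<noteq> 0 \<longleftrightarrow> ints s ''hit'' [] \<noteq> 0 \<or> gains k \<sigma> i h) \<and>
       (ints s' ''edge'' [h, i] \<noteq> 0 \<longleftrightarrow> gains k \<sigma> i h \<and> h < i) \<and>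
       (\<forall>h' i'. (h', i') \<noteq> (h, i) \<longrightarrow> ints s' ''edge'' [h', i'] = ints s ''edge'' [h', i']))"
proof (cases "gains k \<sigma> i h")
  case False
  then have "\<not> (h \<noteq> i \<and> scores s ''empty'' [i] < scores s ''single'' [i, h])"
    using T i h by (auto simp: holds_score_tables_def gains_def)
  with False i h show ?thesis
    unfolding pair_com_def by auto
next
  case True
  then have "h \<noteq> i" "scores s ''empty'' [i] < scores s ''single'' [i, h]"
    "saturated k p \<sigma> i h \<longleftrightarrow> \<not> scores s ''empty'' [i] < scores s ''without'' [i, h] \<and>
       \<not> scores s ''single'' [i, h] < scores s ''others'' [i]"
    using T i h by (auto simp: holds_score_tables_def gains_def saturated_def not_less)
  moreover have "i < h \<or> h < i"
    using \<open>h \<noteq> i\<close> by auto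
  ultimately show ?thesis
    using True i(1) h(1) unfolding pair_com_def by auto
qed

lemma holds_score_tables_cong:
  assumes "holds_score_tables k p \<sigma> s" "ints s' ''p'' [] = ints s ''p'' []"
    and "\<And>x xs. scores s' x xs = scores s x xs"
  shows "holds_score_tables k p \<sigma> s'"
  using assms by (simp add: holds_score_tables_def)

text \<open>The tables are only read and no local score is evaluated, so the time depends on
  \<open>p\<close> alone.\<close>

lemma wp_check_com:
  assumes T: "holds_score_tables k p \<sigma> s"
  shows "wp p \<sigma> \<tau> check_com s
    (\<lambda>t s'. t \<le> check_time p \<and>
       (ints s' ''ok'' [] \<noteq> 0 \<longleftrightarrow> (\<forall>i\<in>nodes p. matching_conditions k p \<sigma> i)) \<and>
       output_graph p s' = candidate k p \<sigma> \<and> ints s' ''p'' [] = p)"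
proof -
  let ?inner = "For ''h'' 1 (var ''p'') pair_com"
  let ?fin = "Cond (BAnd (ILess (var ''hit'') (INum 1)) (SLess (SCell ''empty'' [var ''i'']) (SCell ''others'' [var ''i''])))
          (AssignI ''ok'' [] (INum 0)) Skip"
  let ?body = "AssignI ''hit'' [] (INum 0) ;; ?inner ;; ?fin"
  let ?loop = "For ''i'' 1 (var ''p'') ?body"
  let ?s = "set_int ''ok'' [] 1 s"
  let ?J = "\<lambda>m s'. (ints s' ''ok'' [] \<noteq> 0 \<longleftrightarrow> (\<forall>i\<in>{1..<m}. matching_conditions k p \<sigma> i)) \<and>
    (\<forall>i\<in>{1..<m}. \<forall>h\<in>nodes p. ints s' ''edge'' [h, i] \<noteq> 0 \<longleftrightarrow> gains k \<sigma> i h \<and> h < i)"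
  have p: "ints s ''p'' [] = p"
    using T by (simp add: holds_score_tables_def)
  have "wp p \<sigma> \<tau> ?loop ?s
    (\<lambda>t s'. t \<le> for_time p (for_time p 100 + 20) \<and> ?J (Suc p) s' \<and> frame ?loop ?s s')"
  proof (rule wp_For[where I = ?J])
    fix m s1
    assume m: "1 \<le> m" "m \<le> p" "ints s1 ''i'' [] = m" and f: "frame ?loop ?s s1" and J: "?J m s1"
    have T1: "holds_score_tables k p \<sigma> s1"
      by (rule holds_score_tables_cong[OF T]) (simp_all add: frame_ints[OF f] frame_scores[OF f])
    let ?s1 = "set_int ''hit'' [] 0 s1"
    let ?I = "\<lambda>n s'.
      (ints s' ''ok'' [] \<noteq> 0 \<longleftrightarrow> ints s1 ''ok'' [] \<noteq> 0 \<and>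
        (\<forall>h\<in>{1..<n}. gains k \<sigma> m h \<longrightarrow> saturated k p \<sigma> m h)) \<and>
      (ints s' ''hit'' [] \<noteq> 0 \<longleftrightarrow> (\<exists>h\<in>{1..<n}. gains k \<sigma> m h)) \<and>
      (\<forall>h\<in>{1..<n}. ints s' ''edge'' [h, m] \<noteq> 0 \<longleftrightarrow> gains k \<sigma> m h \<and> h < m) \<and>
      (\<forall>h i. i \<noteq> m \<longrightarrow> ints s' ''edge'' [h, i] = ints s1 ''edge'' [h, i])"
    have "wp p \<sigma> \<tau> ?inner ?s1 (\<lambda>t s'. t \<le> for_time p 100 \<and> ?I (Suc p) s' \<and> frame ?inner ?s1 s')"
    proof (rule wp_For[where I = ?I])
      fix n s2
      assume n: "1 \<le> n" "n \<le> p" "ints s2 ''h'' [] = n" and f: "frame ?inner ?s1 s2" and I: "?I n s2"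
      have T2: "holds_score_tables k p \<sigma> s2"
        by (rule holds_score_tables_cong[OF T1]) (simp_all add: frame_ints[OF f] frame_scores[OF f])
      have i: "ints s2 ''i'' [] = m"
        using m by (simp add: frame_ints[OF f])
      have set: "{1..<Suc n} = insert n {1..<n}"
        using n(1) by auto
      show "wp p \<sigma> \<tau> pair_com s2 (\<lambda>t s3. t \<le> 100 \<and> ?I (Suc n) (set_int ''h'' [] (Suc n) s3))"
      proof (rule wp_mono[OF wp_pair_com[OF T2 i _ n(3)]], goal_cases)
        case (3 t s3)
        then show ?case
          using I unfolding set by auto
      qed (use m n in auto)
    qed (use T1 in \<open>auto simp: holds_score_tables_def\<close>)
    then have "wp p \<sigma> \<tau> ?inner ?s1 (\<lambda>t s'. wp p \<sigma> \<tau> ?fin s' (\<lambda>t' s''. 2 + (t + t') \<le> for_time p 100 + 20 \<and>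
        ?J (Suc m) (set_int ''i'' [] (Suc m) s'')))"
    proof (rule wp_mono, elim conjE)
      fix t s2
      assume t: "t \<le> for_time p 100" and f: "frame ?inner ?s1 s2"
        and ok: "ints s2 ''ok'' [] \<noteq> 0 \<longleftrightarrow> ints s1 ''ok'' [] \<noteq> 0 \<and>
          (\<forall>h\<in>{1..<Suc p}. gains k \<sigma> m h \<longrightarrow> saturated k p \<sigma> m h)"
        and hit: "ints s2 ''hit'' [] \<noteq> 0 \<longleftrightarrow> (\<exists>h\<in>{1..<Suc p}. gains k \<sigma> m h)"
        and edge: "\<forall>h\<in>{1..<Suc p}. ints s2 ''edge'' [h, m] \<noteq> 0 \<longleftrightarrow> gains k \<sigma> m h \<and> h < m"
        and other: "\<forall>h i. i \<noteq> m \<longrightarrow> ints s2 ''edge'' [h, i] = ints s1 ''edge'' [h, i]"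
      have T2: "holds_score_tables k p \<sigma> s2"
        by (rule holds_score_tables_cong[OF T1]) (simp_all add: frame_ints[OF f] frame_scores[OF f])
      have i: "ints s2 ''i'' [] = m"
        using m by (simp add: frame_ints[OF f])
      have cond: "bval s2 (BAnd (ILess (var ''hit'') (INum 1)) (SLess (SCell ''empty'' [var ''i'']) (SCell ''others'' [var ''i''])))
          \<longleftrightarrow> \<not> ((\<exists>h\<in>nodes p. gains k \<sigma> m h) \<or> best_score k \<sigma> m (nodes p - {m}) \<le> best_score k \<sigma> m {})"
        using T2 m hit i by (auto simp: holds_score_tables_def atLeastLessThanSuc_atLeastAtMost)
      have set: "{1..<Suc m} = insert m {1..<m}"
        using m(1) by auto
      have "wp p \<sigma> \<tau> ?fin s2 (\<lambda>t' s3. t' \<le> 15 \<and>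
         (ints s3 ''ok'' [] \<noteq> 0 \<longleftrightarrow> ints s1 ''ok'' [] \<noteq> 0 \<and> matching_conditions k p \<sigma> m) \<and>
         (\<forall>h i. ints s3 ''edge'' [h, i] = ints s2 ''edge'' [h, i]))"
        unfolding wp_Cond cond matching_conditions_alt using ok
        by (simp add: atLeastLessThanSuc_atLeastAtMost)
      then show "wp p \<sigma> \<tau> ?fin s2 (\<lambda>t' s3. 2 + (t + t') \<le> for_time p 100 + 20 \<and>
        ?J (Suc m) (set_int ''i'' [] (Suc m) s3))"
        using t edge other J unfolding set
        by (elim wp_mono) (auto simp: atLeastLessThanSuc_atLeastAtMost)
    qed
    then show "wp p \<sigma> \<tau> ?body s1
        (\<lambda>t s2. t \<le> for_time p 100 + 20 \<and> ?J (Suc m) (set_int ''i'' [] (Suc m) s2))"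
      by (simp add: eval_nat_numeral del: wp_Cond)
  qed (use p in auto)
  then have "wp p \<sigma> \<tau> ?loop ?s (\<lambda>t s'. 2 + t \<le> check_time p \<and>
       (ints s' ''ok'' [] \<noteq> 0 \<longleftrightarrow> (\<forall>i\<in>nodes p. matching_conditions k p \<sigma> i)) \<and>
       output_graph p s' = candidate k p \<sigma> \<and> ints s' ''p'' [] = p)"
  proof (rule wp_mono, elim conjE, intro conjI, goal_cases)
    case (3 t s')
    then have "\<forall>i\<in>nodes p. \<forall>h\<in>nodes p. ints s' ''edge'' [h, i] \<noteq> 0 \<longleftrightarrow> gains k \<sigma> i h \<and> h < i"
      by (simp only: atLeastLessThanSuc_atLeastAtMost)
    then show ?case
      by (auto simp: output_graph_def candidate_def gains_def)
  next
    case (4 t s')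
    then have f: "frame ?loop ?s s'"
      by blast
    show ?case
      using p by (simp add: frame_ints[OF f])
  qed (simp_all add: check_time_def atLeastLessThanSuc_atLeastAtMost)
  then show ?thesis
    unfolding check_com_def by (simp add: eval_nat_numeral)
qed

section \<open>Exhaustive search\<close>

text \<open>The digits of \<open>N\<close> serve as ranks of the nodes. Every column of
  \<open>edge\<close> is rewritten, so the resulting graph owes nothing to what the matrix held
  before.\<close>

definition rank_com :: "nat \<Rightarrow> com" where
  "rank_com k = digits_com ''N'' (var ''p'') ''pos'' ;;
     AssignS ''total'' [] SZero ;;
     For ''i'' 1 (var ''p'')
       (For ''m'' 1 (var ''p'')
          (Cond (ILess (ICell ''pos'' [var ''m'']) (ICell ''pos'' [var ''i'']))
            (AssignI ''U'' [var ''m''] (INum 1)) (AssignI ''U'' [var ''m''] (INum 0))) ;;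
        best_com k ;;
        AssignS ''total'' [] (SAdd (SCell ''total'' []) (SCell ''best'' [])))"

definition rank_arrays :: "string set" where
  "rank_arrays = best_arrays \<union> {''r'', ''l'', ''q'', ''pos'', ''i'', ''m'', ''U''}"

lemma arrays_rank_com [simp]:
  "iarrays (rank_com k) = rank_arrays" "sarrays (rank_com k) = {''total'', ''new'', ''best''}"
  by (auto simp: rank_com_def rank_arrays_def)

definition rank_time :: "nat \<Rightarrow> nat \<Rightarrow> nat \<Rightarrow> nat \<Rightarrow> nat" where
  "rank_time k p B M = digits_time p M + 2 + for_time p (for_time p 12 + best_time k p B + 4)"

abbreviation code_score :: "nat \<Rightarrow> nat \<Rightarrow> local_score \<Rightarrow> nat \<Rightarrow> real" where
  "code_score k p \<sigma> N \<equiv> ranking_score k p \<sigma> (digit (Suc p) N)"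

lemma wp_rank_com:
  assumes p: "ints s ''p'' [] = p" and N: "ints s ''N'' [] = N" "N \<le> M"
    and B: "queries_within k p B \<tau>"
  shows "wp p \<sigma> \<tau> (rank_com k) s
    (\<lambda>t s'. t \<le> rank_time k p B M \<and> scores s' ''total'' [] = code_score k p \<sigma> N \<and>
       output_graph p s' \<in> search_space k p \<and> graph_score p \<sigma> (output_graph p s') = code_score k p \<sigma> N \<and>
       frame (rank_com k) s s')"
proof -
  let ?d = "digit (Suc p) N"
  let ?U = "\<lambda>i. {j \<in> nodes p. ?d j < ?d i}"
  let ?set = "For ''m'' 1 (var ''p'')
          (Cond (ILess (ICell ''pos'' [var ''m'']) (ICell ''pos'' [var ''i'']))
            (AssignI ''U'' [var ''m''] (INum 1)) (AssignI ''U'' [var ''m''] (INum 0)))"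
  let ?add = "AssignS ''total'' [] (SAdd (SCell ''total'' []) (SCell ''best'' []))"
  let ?loop = "For ''i'' 1 (var ''p'') (?set ;; best_com k ;; ?add)"
  let ?T = "for_time p 12 + best_time k p B + 4"
  let ?I = "\<lambda>m s'. scores s' ''total'' [] = (\<Sum>i\<in>{1..<m}. best_score k \<sigma> i (?U i)) \<and>
    (\<forall>i\<in>{1..<m}. column p s' i \<subseteq> ?U i \<and> card (column p s' i) \<le> k \<and>
       \<sigma> i (column p s' i) = best_score k \<sigma> i (?U i))"
  have setU: "wp p \<sigma> \<tau> ?set s1 (\<lambda>t s'. t \<le> for_time p 12 \<and> row_set p s' ''U'' [] = ?U i \<and> frame ?set s1 s')"
    if s1: "ints s1 ''p'' [] = p" "ints s1 ''i'' [] = i" "i \<in> nodes p"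
      "\<forall>l\<in>nodes p. ints s1 ''pos'' [l] = ?d l" for s1 i
  proof -
    let ?K = "\<lambda>m s'. \<forall>j\<in>{1..<m}. ints s' ''U'' [j] = (if ?d j < ?d i then 1 else 0)"
    have "wp p \<sigma> \<tau> ?set s1 (\<lambda>t s'. t \<le> for_time p 12 \<and> ?K (Suc p) s' \<and> frame ?set s1 s')"
    proof (rule wp_For[where I = ?K])
      fix m s2
      assume m: "1 \<le> m" "m \<le> p" "ints s2 ''m'' [] = m" and f: "frame ?set s1 s2" and K: "?K m s2"
      have "ints s2 ''pos'' [m] = ?d m" "ints s2 ''pos'' [i] = ?d i" "ints s2 ''i'' [] = i"
        using s1 m by (simp_all add: frame_ints[OF f])
      then show "wp p \<sigma> \<tau> (Cond (ILess (ICell ''pos'' [var ''m'']) (ICell ''pos'' [var ''i'']))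
            (AssignI ''U'' [var ''m''] (INum 1)) (AssignI ''U'' [var ''m''] (INum 0))) s2
          (\<lambda>t s3. t \<le> 12 \<and> ?K (Suc m) (set_int ''m'' [] (Suc m) s3))"
        using m K by (auto simp: less_Suc_eq)
    qed (use s1 in auto)
    then show ?thesis
    proof (rule wp_mono, elim conjE, intro conjI)
      fix t and s' :: state
      assume "?K (Suc p) s'"
      then show "row_set p s' ''U'' [] = ?U i"
        by (auto simp: row_set_def atLeastLessThanSuc_atLeastAtMost split: if_splits)
    qed
  qed
  have loop: "wp p \<sigma> \<tau> ?loop s1 (\<lambda>t s'. t \<le> for_time p ?T \<and> ?I (Suc p) s' \<and> frame ?loop s1 s')"
    if s1: "ints s1 ''p'' [] = p" "\<forall>l\<in>nodes p. ints s1 ''pos'' [l] = ?d l" "scores s1 ''total'' [] = 0" for s1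
  proof (rule wp_For[where I = ?I])
    fix m s2
    assume m: "1 \<le> m" "m \<le> p" "ints s2 ''i'' [] = m" and f: "frame ?loop s1 s2" and I: "?I m s2"
    have s2: "ints s2 ''p'' [] = p" "\<forall>l\<in>nodes p. ints s2 ''pos'' [l] = ?d l"
      using s1 by (simp_all add: frame_ints[OF f] best_arrays_def)
    have mn: "m \<in> nodes p"
      using m by simp
    show "wp p \<sigma> \<tau> (?set ;; best_com k ;; ?add) s2
        (\<lambda>t s3. t \<le> ?T \<and> ?I (Suc m) (set_int ''i'' [] (Suc m) s3))"
      unfolding wp_Seq
    proof (rule wp_mono[OF setU[OF s2(1) m(3) mn s2(2)]], elim conjE)
      fix t3 s3
      assume t3: "t3 \<le> for_time p 12" and U: "row_set p s3 ''U'' [] = ?U m" and f3: "frame ?set s2 s3"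
      have s3: "ints s3 ''p'' [] = p" "ints s3 ''i'' [] = m" "column p s3 i = column p s2 i"
        "scores s3 ''total'' [] = scores s2 ''total'' []" for i
        using s2 m by (simp_all add: frame_ints[OF f3] frame_scores[OF f3] column_def)
      show "wp p \<sigma> \<tau> (best_com k) s3 (\<lambda>t s'. wp p \<sigma> \<tau> ?add s'
          (\<lambda>t' s''. t3 + (t + t') \<le> ?T \<and> ?I (Suc m) (set_int ''i'' [] (Suc m) s'')))"
      proof (rule wp_mono[OF wp_best_com[OF s3(1,2) mn U _ B]], goal_cases)
        case (2 t4 s4)
        then have f4: "frame (best_com k) s3 s4"
          by simp
        have total: "scores s4 ''total'' [] = scores s2 ''total'' []"
          using s3 by (simp add: frame_scores[OF f4])
        have col: "column p (set_int ''i'' [] n (set_score x xs r s4)) i = column p s4 i" for n x xs r i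
          by (simp add: column_def)
        have set: "{1..<Suc m} = insert m {1..<m}"
          using m(1) by auto
        have "column p s4 i = column p s2 i" if "i \<in> {1..<m}" for i
          using that 2 s3(3) by simp
        then show ?case
          using 2 t3 I unfolding set by (simp add: total col)
      qed simp
    qed
  qed (use s1 in \<open>auto simp: best_arrays_def\<close>)
  have "wp p \<sigma> \<tau> (rank_com k) s (\<lambda>t s'. t \<le> rank_time k p B M \<and> ?I (Suc p) s')"
    unfolding rank_com_def wp_Seq
  proof (rule wp_mono[OF wp_digits_com[OF p, of "var ''p''" p "''pos''" "''N''" M]], goal_cases)
    case (6 t1 s1)
    then have f: "frame (digits_com ''N'' (var ''p'') ''pos'') s s1"
      by simp
    have "wp p \<sigma> \<tau> ?loop (set_score ''total'' [] 0 s1)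
      (\<lambda>t s'. t \<le> for_time p ?T \<and> ?I (Suc p) s' \<and> frame ?loop (set_score ''total'' [] 0 s1) s')"
      using 6 p N by (intro loop) (simp_all add: frame_ints[OF f])
    then have "wp p \<sigma> \<tau> ?loop (set_score ''total'' [] 0 s1)
      (\<lambda>t s'. t1 + (2 + t) \<le> rank_time k p B M \<and> ?I (Suc p) s')"
      using 6 by (elim wp_mono) (simp add: rank_time_def)
    then show ?case
      by (simp add: eval_nat_numeral)
  qed (use p N in auto)
  from wp_frame[OF this] show ?thesis
  proof (rule wp_mono, elim conjE, goal_cases)
    case (1 t s')
    have set: "{1..<Suc p} = nodes p"
      by auto
    note cols = \<open>\<forall>i\<in>{1..<Suc p}. _ i\<close>[unfolded set]
    have "output_graph p s' \<in> search_space k p"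
    \<comment> \<open>The ranking itself certifies acyclicity: all parents have a strictly smaller
      rank.\<close>
    proof (rule ranking_search_space[of _ _ ?d])
      fix j i
      assume "(j, i) \<in> output_graph p s'"
      then have "i \<in> nodes p" "j \<in> column p s' i"
        by (auto simp: output_graph_def column_def)
      with cols show "?d j < ?d i"
        by blast
    qed (use cols in \<open>auto simp: parents_output_graph, auto simp: output_graph_def\<close>)
    moreover have "graph_score p \<sigma> (output_graph p s') = code_score k p \<sigma> N"
      unfolding graph_score_def ranking_score_def
      using cols by (intro sum.cong refl) (simp add: parents_output_graph)
    ultimately show ?case
      using 1 unfolding set by (simp add: ranking_score_def)
  qed
qed

text \<open>Only the code of the best ranking is stored; its graph is recomputed at the end.\<close>

definition search_com :: "nat \<Rightarrow> com" where
  "search_com k = power_com (var ''p'') ''W'' ;;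
     AssignI ''N'' [] (INum 0) ;;
     rank_com k ;;
     AssignS ''top'' [] (SCell ''total'' []) ;;
     AssignI ''arg'' [] (INum 0) ;;
     For ''N'' 0 (var ''W'')
       (rank_com k ;;
        Cond (SLess (SCell ''top'' []) (SCell ''total'' []))
          (AssignS ''top'' [] (SCell ''total'' []) ;; AssignI ''arg'' [] (var ''N'')) Skip) ;;
     AssignI ''N'' [] (var ''arg'') ;;
     rank_com k"

text \<open>Counting ancestors ranks the nodes of \<open>E\<close> by numbers up to
  \<open>p\<close>, which are digits in base \<open>p + 1\<close>; choosing the best parents of
  lower rank is then at least as good as \<open>E\<close>.\<close>

lemma exists_code_score:
  assumes "E \<in> search_space k p"
  shows "\<exists>N\<le>Suc p ^ p. graph_score p \<sigma> E \<le> code_score k p \<sigma> N"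
proof -
  have "dag p E"
    using assms by (simp add: search_space_def)
  then obtain r where r: "\<And>j i. (j, i) \<in> E \<Longrightarrow> r j < r i" "\<And>i. r i \<le> p"
    using dag_ranking by blast
  then obtain N where N: "N < Suc p ^ p" "\<forall>l\<in>nodes p. digit (Suc p) N l = r l"
    using exists_digits[of p r "Suc p"] unfolding digit_def by (auto simp: less_Suc_eq_le)
  have "E \<subseteq> nodes p \<times> nodes p"
    using \<open>dag p E\<close> by (simp add: dag_def)
  then have "digit (Suc p) N j < digit (Suc p) N i" if "(j, i) \<in> E" for j i
    using r(1)[OF that] N(2) that by auto
  then have "graph_score p \<sigma> E \<le> code_score k p \<sigma> N"
    by (intro graph_score_le_ranking_score assms)
  with N(1) show ?thesis
    by (intro exI[of _ N]) simp
qed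

text \<open>The postcondition leaves the time open: exponentially many rankings are tried, and the
  complete algorithm resorts to this only if no optimal graph is a matching.\<close>

lemma wp_search_com:
  assumes p: "ints s ''p'' [] = p" and B: "queries_within k p B \<tau>"
  shows "wp p \<sigma> \<tau> (search_com k) s (\<lambda>t s'. optimal_dag k p \<sigma> (output_graph p s'))"
proof -
  let ?W = "Suc p ^ p"
  let ?body = "rank_com k ;;
        Cond (SLess (SCell ''top'' []) (SCell ''total'' []))
          (AssignS ''top'' [] (SCell ''total'' []) ;; AssignI ''arg'' [] (var ''N'')) Skip"
  let ?loop = "For ''N'' 0 (var ''W'') ?body"
  let ?I = "\<lambda>m s'. scores s' ''top'' [] = code_score k p \<sigma> (ints s' ''arg'' []) \<and>
    (\<forall>N<m. code_score k p \<sigma> N \<le> code_score k p \<sigma> (ints s' ''arg'' []))"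
  have loop: "wp p \<sigma> \<tau> ?loop s1
      (\<lambda>t s'. t \<le> for_time ?W (rank_time k p B ?W + 20) \<and> ?I (Suc ?W) s' \<and> frame ?loop s1 s')"
    if s1: "ints s1 ''p'' [] = p" "ints s1 ''W'' [] = ?W" "?I 0 s1" for s1
  proof (rule wp_For[where I = ?I])
    fix m s2
    assume m: "0 \<le> m" "m \<le> ?W" "ints s2 ''N'' [] = m" and f: "frame ?loop s1 s2" and I: "?I m s2"
    have s2: "ints s2 ''p'' [] = p"
      using s1 by (simp add: frame_ints[OF f] rank_arrays_def best_arrays_def)
    show "wp p \<sigma> \<tau> ?body s2
      (\<lambda>t s3. t \<le> rank_time k p B ?W + 20 \<and> ?I (Suc m) (set_int ''N'' [] (Suc m) s3))"
      unfolding wp_Seq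
    proof (rule wp_mono[OF wp_rank_com[OF s2 m(3,2) B]], elim conjE)
      fix t s3
      assume t: "t \<le> rank_time k p B ?W" and total: "scores s3 ''total'' [] = code_score k p \<sigma> m"
        and f: "frame (rank_com k) s2 s3"
      have s3: "scores s3 ''top'' [] = scores s2 ''top'' []" "ints s3 ''arg'' [] = ints s2 ''arg'' []"
        "ints s3 ''N'' [] = m"
        using m by (simp_all add: frame_ints[OF f] frame_scores[OF f] rank_arrays_def best_arrays_def)
      show "wp p \<sigma> \<tau> (Cond (SLess (SCell ''top'' []) (SCell ''total'' []))
          (AssignS ''top'' [] (SCell ''total'' []) ;; AssignI ''arg'' [] (var ''N'')) Skip) s3
        (\<lambda>t' s4. t + t' \<le> rank_time k p B ?W + 20 \<and> ?I (Suc m) (set_int ''N'' [] (Suc m) s4))"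
        using t total s3 I by (auto simp: less_Suc_eq not_less intro: order_trans less_imp_le)
    qed
  qed (use s1 in \<open>auto simp: rank_arrays_def best_arrays_def\<close>)
  show ?thesis
    unfolding search_com_def wp_Seq
  proof (rule wp_mono[OF wp_power_com[OF p, of "var ''p''" p "''W''"]], goal_cases)
    case (5 t1 s1)
    then have f: "frame (power_com (var ''p'') ''W'') s s1"
      by simp
    let ?s1 = "set_int ''N'' [] 0 s1"
    have s1: "ints ?s1 ''p'' [] = p" "ints ?s1 ''N'' [] = 0" "ints ?s1 ''W'' [] = ?W"
      using p 5 by (simp_all add: frame_ints[OF f])
    have "wp p \<sigma> \<tau> (rank_com k) ?s1 (\<lambda>t2 s2.
      wp p \<sigma> \<tau> ?loop (set_int ''arg'' [] 0 (set_score ''top'' [] (scores s2 ''total'' []) s2)) (\<lambda>t3 s3.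
      wp p \<sigma> \<tau> (rank_com k) (set_int ''N'' [] (ints s3 ''arg'' []) s3)
        (\<lambda>t4 s'. optimal_dag k p \<sigma> (output_graph p s'))))"
    proof (rule wp_mono[OF wp_rank_com[OF s1(1,2) le0 B]], elim conjE)
      fix t2 s2
      assume total: "scores s2 ''total'' [] = code_score k p \<sigma> 0" and f: "frame (rank_com k) ?s1 s2"
      let ?s2 = "set_int ''arg'' [] 0 (set_score ''top'' [] (scores s2 ''total'' []) s2)"
      have s2: "ints ?s2 ''p'' [] = p" "ints ?s2 ''W'' [] = ?W" "?I 0 ?s2"
        using s1 total by (simp_all add: frame_ints[OF f] rank_arrays_def best_arrays_def)
      show "wp p \<sigma> \<tau> ?loop ?s2 (\<lambda>t3 s3.
        wp p \<sigma> \<tau> (rank_com k) (set_int ''N'' [] (ints s3 ''arg'' []) s3)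
          (\<lambda>t4 s'. optimal_dag k p \<sigma> (output_graph p s')))"
      proof (rule wp_mono[OF loop[OF s2]], elim conjE)
        fix t3 s3
        assume best: "\<forall>N<Suc ?W. code_score k p \<sigma> N \<le> code_score k p \<sigma> (ints s3 ''arg'' [])"
          and f: "frame ?loop ?s2 s3"
        let ?s3 = "set_int ''N'' [] (ints s3 ''arg'' []) s3"
        have s3: "ints ?s3 ''p'' [] = p" "ints ?s3 ''N'' [] = ints s3 ''arg'' []"
          using s2 by (simp_all add: frame_ints[OF f] rank_arrays_def best_arrays_def)
        show "wp p \<sigma> \<tau> (rank_com k) ?s3 (\<lambda>t4 s'. optimal_dag k p \<sigma> (output_graph p s'))"
        proof (rule wp_mono[OF wp_rank_com[OF s3 order_refl B]], elim conjE)
          fix t4 s4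
          assume "output_graph p s4 \<in> search_space k p"
            "graph_score p \<sigma> (output_graph p s4) = code_score k p \<sigma> (ints s3 ''arg'' [])"
          \<comment> \<open>Every competitor is dominated by some code in the range of the loop, and
            the best code is itself realised by the output.\<close>
          moreover have "graph_score p \<sigma> E \<le> code_score k p \<sigma> (ints s3 ''arg'' [])"
            if E: "E \<in> search_space k p" for E
            using exists_code_score[OF E, of \<sigma>] best by (auto simp: less_Suc_eq_le intro: order_trans)
          ultimately show "optimal_dag k p \<sigma> (output_graph p s4)"
            by (simp add: optimal_dag_def)
        qed
      qed
    qed
    then show ?case
      by simp
  qed (use p in auto)
qed

section \<open>The complete algorithm\<close>

definition discover_com :: "nat \<Rightarrow> com" where
  "discover_com k = check_com ;; Cond (ILess (var ''ok'') (INum 1)) (search_com k) Skip"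

text \<open>For fixed \<open>p\<close> only finitely many sets can be queried, so any
  \<open>\<tau>\<close> is bounded by a sum. Exactness has to hold for arbitrary evaluation times,
  and this makes the timed rules applicable to them.\<close>

lemma queries_within_exists: "\<exists>B. queries_within k p B \<tau>"
proof -
  have "\<tau> i Pa \<le> (\<Sum>i\<in>nodes p. \<Sum>Pa\<in>Pow (nodes p). \<tau> i Pa)" if "i \<in> nodes p" "Pa \<subseteq> nodes p" for i Pa
  proof -
    have "\<tau> i Pa \<le> (\<Sum>Pa\<in>Pow (nodes p). \<tau> i Pa)"
      using that by (intro member_le_sum) auto
    also have "\<dots> \<le> (\<Sum>i\<in>nodes p. \<Sum>Pa\<in>Pow (nodes p). \<tau> i Pa)"
      using that by (intro member_le_sum) auto
    finally show ?thesis .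
  qed
  then show ?thesis
    unfolding queries_within_def by (meson Diff_subset order_trans)
qed

text \<open>If the test succeeds, \<open>candidate_optimal\<close> applies; if it fails,
  \<open>optimal_matching_conditions\<close> excludes an optimal matching. Under the promise the
  search is thus never entered, and the conditional adds 5 steps: 4 for the branch and 1 for
  \<open>Skip\<close>.\<close>

lemma wp_discover_com:
  assumes equiv: "pairwise_score_equivalent p \<sigma>" and T: "holds_score_tables k p \<sigma> s"
  shows "wp p \<sigma> \<tau> (discover_com k) s (\<lambda>t s'. optimal_dag k p \<sigma> (output_graph p s') \<and>
    ((\<exists>M. optimal_dag k p \<sigma> M \<and> matching_dag p M) \<longrightarrow>
       matching_dag p (output_graph p s') \<and> t \<le> check_time p + 5))"
  unfolding discover_com_def wp_Seq
proof (rule wp_mono[OF wp_check_com[OF T]], elim conjE)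
  fix t s1
  assume t: "t \<le> check_time p"
    and ok: "ints s1 ''ok'' [] \<noteq> 0 \<longleftrightarrow> (\<forall>i\<in>nodes p. matching_conditions k p \<sigma> i)"
    and out: "output_graph p s1 = candidate k p \<sigma>" and p: "ints s1 ''p'' [] = p"
  show "wp p \<sigma> \<tau> (Cond (ILess (var ''ok'') (INum 1)) (search_com k) Skip) s1
    (\<lambda>t' s'. optimal_dag k p \<sigma> (output_graph p s') \<and>
      ((\<exists>M. optimal_dag k p \<sigma> M \<and> matching_dag p M) \<longrightarrow>
         matching_dag p (output_graph p s') \<and> t + t' \<le> check_time p + 5))"
  proof (cases "\<forall>i\<in>nodes p. matching_conditions k p \<sigma> i")
    case True
    with candidate_optimal[OF equiv True] ok out t show ?thesis
      by simp
  next
    case False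
    obtain B where "queries_within k p B \<tau>"
      using queries_within_exists by blast
    note search = wp_search_com[OF p this]
    from False have "\<not> (\<exists>M. optimal_dag k p \<sigma> M \<and> matching_dag p M)"
      using optimal_matching_conditions[OF equiv] by blast
    moreover have "ints s1 ''ok'' [] = 0"
      using False ok by blast
    ultimately show ?thesis
      by (simp add: wp_mono[OF search])
  qed
qed

section \<open>Polynomial and quadratic growth of the time bounds\<close>

lemma polynomially_bounded_mono:
  assumes "polynomially_bounded f" "\<And>p. \<bar>g p\<bar> \<le> \<bar>f p\<bar>"
  shows "polynomially_bounded g"
proof -
  have "g \<in> O(f)"
    by (intro landau_o.big_mono always_eventually allI) (use assms(2) in simp)
  then show ?thesis
    using assms(1) unfolding polynomially_bounded_def by (blast intro: landau_o.big_trans)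
qed

lemma polynomially_bounded_const: "polynomially_bounded (\<lambda>p. c)"
  unfolding polynomially_bounded_def by (intro exI[of _ 0]) simp

lemma polynomially_bounded_nodes: "polynomially_bounded real"
  unfolding polynomially_bounded_def by (intro exI[of _ 1]) simp

lemma power_in_bigo_power: "d \<le> e \<Longrightarrow> (\<lambda>p. real p ^ d) \<in> O(\<lambda>p. real p ^ e)"
  by (intro landau_o.big_mono eventually_mono[OF eventually_ge_at_top[of 1]])
    (simp add: power_increasing)

lemma polynomially_bounded_add:
  assumes "polynomially_bounded f" "polynomially_bounded g"
  shows "polynomially_bounded (\<lambda>p. f p + g p)"
proof -
  obtain d e where "f \<in> O(\<lambda>p. real p ^ d)" "g \<in> O(\<lambda>p. real p ^ e)"
    using assms unfolding polynomially_bounded_def by blast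
  note this[THEN landau_o.big_trans]
  then have "f \<in> O(\<lambda>p. real p ^ max d e)" "g \<in> O(\<lambda>p. real p ^ max d e)"
    by (simp_all add: power_in_bigo_power)
  then show ?thesis
    unfolding polynomially_bounded_def by (blast intro: sum_in_bigo)
qed

lemma polynomially_bounded_mult:
  assumes "polynomially_bounded f" "polynomially_bounded g"
  shows "polynomially_bounded (\<lambda>p. f p * g p)"
proof -
  obtain d e where "f \<in> O(\<lambda>p. real p ^ d)" "g \<in> O(\<lambda>p. real p ^ e)"
    using assms unfolding polynomially_bounded_def by blast
  then have "(\<lambda>p. f p * g p) \<in> O(\<lambda>p. real p ^ d * real p ^ e)"
    by (rule landau_o.big.mult)
  then show ?thesis
    unfolding polynomially_bounded_def power_add[symmetric] by blast
qed

lemma polynomially_bounded_power: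
  "polynomially_bounded f \<Longrightarrow> polynomially_bounded (\<lambda>p. f p ^ n)"
  by (induction n) (auto intro: polynomially_bounded_const polynomially_bounded_mult)

lemma polynomially_bounded_for_time:
  assumes "polynomially_bounded (\<lambda>p. real (n p))" "polynomially_bounded (\<lambda>p. real (T p))"
  shows "polynomially_bounded (\<lambda>p. real (for_time (n p) (T p)))"
  unfolding for_time_def of_nat_add of_nat_mult of_nat_Suc
  by (intro polynomially_bounded_add polynomially_bounded_mult polynomially_bounded_const assms)

lemmas polynomially_bounded_intros =
  polynomially_bounded_for_time polynomially_bounded_add polynomially_bounded_mult
  polynomially_bounded_power polynomially_bounded_const polynomially_bounded_nodes

text \<open>The in-degree bound \<open>k\<close> is a constant while \<open>p\<close> varies, so the
  number \<open>Suc p ^ k\<close> of codes is polynomial; all other ingredients are nested loops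
  over nodes or digits.\<close>

lemma polynomially_bounded_tables_time:
  assumes "polynomially_bounded (\<lambda>p. real (B p))"
  shows "polynomially_bounded (\<lambda>p. real (tables_time k p (B p)))"
proof -
  have power: "polynomially_bounded (\<lambda>p. real (Suc p ^ k))"
    unfolding of_nat_power of_nat_Suc by (intro polynomially_bounded_intros)
  show ?thesis
    unfolding tables_time_def entry_time_def best_time_def record_time_def power_time_def
      select_time_def digits_time_def
    by (intro polynomially_bounded_intros power assms | simp only: of_nat_add of_nat_mult)+
qed

text \<open>A time bound \<open>q\<close> may be fractional or even negative, while
  \<open>queries_within\<close> takes a natural number; rounding up exceeds the absolute value by at
  most 1.\<close>

lemma polynomially_bounded_nat_ceiling:
  assumes "polynomially_bounded q"
  shows "polynomially_bounded (\<lambda>p. real (nat \<lceil>q p\<rceil>))"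
proof (rule polynomially_bounded_mono)
  show "polynomially_bounded (\<lambda>p. \<bar>q p\<bar> + 1)"
    by (intro polynomially_bounded_add polynomially_bounded_const)
      (rule polynomially_bounded_mono[OF assms], simp)
qed linarith

lemma queries_within_nat_ceiling:
  assumes "eval_time_within k p b \<tau>"
  shows "queries_within k p (nat \<lceil>b\<rceil>) \<tau>"
proof -
  have "m \<le> nat \<lceil>b\<rceil>" if "real m \<le> b" for m
    using that by linarith
  with assms show ?thesis
    unfolding queries_within_def eval_time_within_def by blast
qed

lemma check_time_bigo: "(\<lambda>p. real (check_time p + 5)) \<in> O(\<lambda>p. real p ^ 2)"
proof (rule bigoI[where c = 1000], rule eventually_mono[OF eventually_ge_at_top[of 1]])
  fix p :: nat
  assume "1 \<le> p"
  then have "1 \<le> p ^ 2" "p \<le> p ^ 2"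
    by (simp_all add: self_le_power)
  \<comment> \<open>For \<open>p \<ge> 1\<close> each term is at most its coefficient times
    \<open>p ^ 2\<close>, and the coefficients add up to 522, well below 1000.\<close>
  moreover have "check_time p + 5 = 109 * p ^ 2 + 254 * p + 159"
    by (simp add: check_time_def for_time_def algebra_simps power2_eq_square)
  ultimately have "check_time p + 5 \<le> 1000 * p ^ 2"
    by linarith
  then have "real (check_time p + 5) \<le> real (1000 * p ^ 2)"
    by (rule of_nat_mono)
  then show "norm (real (check_time p + 5)) \<le> 1000 * norm (real p ^ 2)"
    by simp
qed

theorem mainTheorem1:
  fixes k :: nat
  shows "\<exists>tables discover.
    exact_discovery k (\<lambda>p \<sigma> s. s = init_state p) (tables ;; discover) \<and>
    exact_discovery k (holds_score_tables k) discover \<and>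
    (\<forall>p \<sigma> \<tau>. pairwise_score_equivalent p \<sigma> \<longrightarrow>
       (\<exists>t s. exec p \<sigma> \<tau> tables (init_state p) t s \<and> holds_score_tables k p \<sigma> s)) \<and>
    (\<forall>q. polynomially_bounded q \<longrightarrow>
       (\<exists>T. polynomially_bounded T \<and>
          (\<forall>p \<sigma> \<tau>. pairwise_score_equivalent p \<sigma> \<longrightarrow> eval_time_within k p (q p) \<tau> \<longrightarrow>
             (\<exists>M. optimal_dag k p \<sigma> M \<and> matching_dag p M) \<longrightarrow>
             (\<exists>t E. returns p \<sigma> \<tau> (tables ;; discover) (init_state p) t E \<and>
                optimal_dag k p \<sigma> E \<and> matching_dag p E \<and> real t \<le> T p)))) \<and>
    (\<exists>T. T \<in> O(\<lambda>p. real p ^ 2) \<and>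
       (\<forall>p \<sigma> \<tau> s. pairwise_score_equivalent p \<sigma> \<longrightarrow> holds_score_tables k p \<sigma> s \<longrightarrow>
          (\<exists>M. optimal_dag k p \<sigma> M \<and> matching_dag p M) \<longrightarrow>
          (\<exists>t E. returns p \<sigma> \<tau> discover s t E \<and>
             optimal_dag k p \<sigma> E \<and> matching_dag p E \<and> real t \<le> T p)))"
proof -
  let ?tables = "tables_com k" and ?discover = "discover_com k"
  have discover: "\<exists>t s'. exec p \<sigma> \<tau> ?discover s t s' \<and> optimal_dag k p \<sigma> (output_graph p s') \<and>
      ((\<exists>M. optimal_dag k p \<sigma> M \<and> matching_dag p M) \<longrightarrow>
         matching_dag p (output_graph p s') \<and> t \<le> check_time p + 5)"
    if "pairwise_score_equivalent p \<sigma>" "holds_score_tables k p \<sigma> s" for p \<sigma> \<tau> s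
    using wp_discover_com[OF that] unfolding wp_def by blast
  have tables: "\<exists>t s'. exec p \<sigma> \<tau> ?tables (init_state p) t s' \<and> t \<le> tables_time k p B \<and>
      holds_score_tables k p \<sigma> s'" if "queries_within k p B \<tau>" for p \<sigma> \<tau> B
    using wp_tables_com[OF _ that, of "init_state p"] unfolding wp_def by (simp add: init_state_def)
  have both: "\<exists>t s'. exec p \<sigma> \<tau> (?tables ;; ?discover) (init_state p) t s' \<and>
      optimal_dag k p \<sigma> (output_graph p s') \<and>
      ((\<exists>M. optimal_dag k p \<sigma> M \<and> matching_dag p M) \<longrightarrow>
         matching_dag p (output_graph p s') \<and> t \<le> tables_time k p B + (check_time p + 5))"
    if equiv: "pairwise_score_equivalent p \<sigma>" and B: "queries_within k p B \<tau>" for p \<sigma> \<tau> B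
  proof -
    obtain t1 s1 where 1: "exec p \<sigma> \<tau> ?tables (init_state p) t1 s1" "t1 \<le> tables_time k p B"
      "holds_score_tables k p \<sigma> s1"
      using tables[OF B] by blast
    obtain t2 s2 where 2: "exec p \<sigma> \<tau> ?discover s1 t2 s2" "optimal_dag k p \<sigma> (output_graph p s2)"
      "(\<exists>M. optimal_dag k p \<sigma> M \<and> matching_dag p M) \<longrightarrow>
         matching_dag p (output_graph p s2) \<and> t2 \<le> check_time p + 5"
      using discover[OF equiv 1(3)] by blast
    from exec.Seq[OF 1(1) 2(1)] 1(2) 2(2,3) show ?thesis
      by (meson add_mono)
  qed
  show ?thesis
  proof (rule exI[of _ ?tables], rule exI[of _ ?discover], intro conjI allI impI)
    show "exact_discovery k (\<lambda>p \<sigma> s. s = init_state p) (?tables ;; ?discover)"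
      unfolding exact_discovery_def
    proof (intro allI impI)
      fix p \<sigma> \<tau> s
      assume equiv: "pairwise_score_equivalent p \<sigma>" and s: "s = init_state p"
      obtain B where "queries_within k p B \<tau>"
        using queries_within_exists by blast
      from both[OF equiv this] show "\<exists>t E. returns p \<sigma> \<tau> (?tables ;; ?discover) s t E \<and>
          optimal_dag k p \<sigma> E"
        unfolding returns_def s by blast
    qed
    show "exact_discovery k (holds_score_tables k) ?discover"
      unfolding exact_discovery_def returns_def using discover by blast
    show "\<exists>t s. exec p \<sigma> \<tau> ?tables (init_state p) t s \<and> holds_score_tables k p \<sigma> s" for p \<sigma> \<tau>
      using tables queries_within_exists by blast
  next
    fix q
    assume q: "polynomially_bounded q"
    \<comment> \<open>The bound must be fixed before the score and the evaluation times are known,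
      so it is built from \<open>k\<close> and \<open>q\<close> only.\<close>
    let ?T = "\<lambda>p. real (tables_time k p (nat \<lceil>q p\<rceil>)) + real (check_time p + 5)"
    have "polynomially_bounded ?T"
      using check_time_bigo
      by (intro polynomially_bounded_add polynomially_bounded_tables_time
          polynomially_bounded_nat_ceiling q) (auto simp: polynomially_bounded_def)
    moreover have "\<exists>t E. returns p \<sigma> \<tau> (?tables ;; ?discover) (init_state p) t E \<and>
        optimal_dag k p \<sigma> E \<and> matching_dag p E \<and> real t \<le> ?T p"
      if prems: "pairwise_score_equivalent p \<sigma>" "eval_time_within k p (q p) \<tau>"
        "\<exists>M. optimal_dag k p \<sigma> M \<and> matching_dag p M" for p \<sigma> \<tau>
    proof -
      obtain t s' where "exec p \<sigma> \<tau> (?tables ;; ?discover) (init_state p) t s'"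
        "optimal_dag k p \<sigma> (output_graph p s')" "matching_dag p (output_graph p s')"
        and t: "t \<le> tables_time k p (nat \<lceil>q p\<rceil>) + (check_time p + 5)"
        using both[OF prems(1) queries_within_nat_ceiling[OF prems(2)]] prems(3) by blast
      moreover have "real t \<le> ?T p"
        using of_nat_mono[OF t] by simp
      ultimately show ?thesis
        unfolding returns_def by blast
    qed
    ultimately show "\<exists>T. polynomially_bounded T \<and>
          (\<forall>p \<sigma> \<tau>. pairwise_score_equivalent p \<sigma> \<longrightarrow> eval_time_within k p (q p) \<tau> \<longrightarrow>
             (\<exists>M. optimal_dag k p \<sigma> M \<and> matching_dag p M) \<longrightarrow>
             (\<exists>t E. returns p \<sigma> \<tau> (?tables ;; ?discover) (init_state p) t E \<and>
                optimal_dag k p \<sigma> E \<and> matching_dag p E \<and> real t \<le> T p))"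
      by (intro exI[of _ ?T]) blast
  next
    show "\<exists>T. T \<in> O(\<lambda>p. real p ^ 2) \<and>
       (\<forall>p \<sigma> \<tau> s. pairwise_score_equivalent p \<sigma> \<longrightarrow> holds_score_tables k p \<sigma> s \<longrightarrow>
          (\<exists>M. optimal_dag k p \<sigma> M \<and> matching_dag p M) \<longrightarrow>
          (\<exists>t E. returns p \<sigma> \<tau> ?discover s t E \<and>
             optimal_dag k p \<sigma> E \<and> matching_dag p E \<and> real t \<le> T p))"
    proof (rule exI[of _ "\<lambda>p. real (check_time p + 5)"], intro conjI allI impI check_time_bigo)
      fix p \<sigma> \<tau> s
      assume "pairwise_score_equivalent p \<sigma>" "holds_score_tables k p \<sigma> s"
        "\<exists>M. optimal_dag k p \<sigma> M \<and> matching_dag p M"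
      then show "\<exists>t E. returns p \<sigma> \<tau> ?discover s t E \<and> optimal_dag k p \<sigma> E \<and> matching_dag p E \<and>
          real t \<le> real (check_time p + 5)"
        using discover[of p \<sigma> s \<tau>] unfolding returns_def of_nat_le_iff by blast
    qed
  qed
qed

end
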